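(* Let $F$ be a field, let $(\mathcal K,g)$ be a finite filtered chain complex over $F$, let $\mathbb M$ be a vital filtered Morse construction, and let $\mathbb M^{\infty}(\mathcal K)$ be the iterated Morse complex, i.e. the fixed point of $\mathcal K,\mathbb M(\mathcal K),\mathbb M^2(\mathcal K),\dots$, all Morse matchings used being compatible with the filtration. Then: (Correctness) $\mathcal K$ and $\mathbb M^{\infty}(\mathcal K)$ have the same persistence, i.e. for every $p$ the multisets of $p$-dimensional persistence intervals of $\mathcal K$ and of $\mathbb M^{\infty}(\mathcal K)$ are equal. (Optimality) Every cell $A\in\mathbb M^{\infty}(\mathcal K)$ either starts or terminates a persistence interval of nonzero length.
   Context: **Chain complexes.** A finite chain complex $\mathcal K$ over $F$ means a finite set of cells, each with a dimension $\dim A\in\mathbb Z_{\ge 0}$, with incidence indices $\kappa(A,b)\in F$ for cells with $\dim A=\dim b+1$ (and $\kappa(A,b)=0$ for all other pairs), such that $\partial A=\sum_b\kappa(A,b)\,b$, extended linearly to the free $F$-modules $C_p$ on $p$-cells, satisfies $\partial\partial=0$. If $\kappa(A,b)\ne 0$, $b$ is a face of $A$. It is filtered by $g:\mathcal K\to\mathbb Z$ if $g(b)\le g(A)$ whenever $b$ is a face of $A$; then $\mathcal K_t=\{A: g(A)\le t\}$ is a subcomplex for each $t\in\mathbb Z$. **Morse matchings and complexes.** A matching $M$ is a set of pairwise disjoint pairs $(A,b)$ with $\kappa(A,b)\neq0$; unmatched cells are critical. Its Morse graph is the directed graph on the cells with an edge $A\to b$ for each $\kappa(A,b)\ne0$ with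 $(A,b)\notin M$, and an edge $b\to A$ for each $(A,b)\in M$. $M$ is acyclic if this graph has no directed cycle. All matchings are assumed acyclic. $M$ is compatible with the filtration if $g(A)=g(b)$ for all $(A,b)\in M$. The Morse complex of $M$ has as cells the critical cells (same dimensions, same values of $g$), with incidence of critical $s$ and $c$, $\dim s=\dim c+1$, equal to the sum, over all directed paths $s=A_0\to a_1\to A_1\to a_2\to\dots\to a_k\to A_k\to c$ ($k\ge0$, $(A_i,a_i)\in M$ for $1\le i\le k$) in the Morse graph, of $(-1)^k\,\kappa(A_0,a_1)\prod_{i=1}^{k}\kappa(A_i,a_i)^{-1}\kappa(A_i,a_{i+1})$, where $a_{k+1}:=c$. (Over $\mathbb Z_2$: the number of such paths mod 2.) **Vital filtered Morse construction.** An assignment $\mathbb M$ sending each finite filtered chain complex to the Morse complex of some acyclic matching on it compatible with its filtration, such that (vitality) this matching is nonempty whenever there are cells $A,b$ with $\kappa(A,b)\neq0$ and $g(A)=g(b)$. Nothing else is assumed about $\mathbb M$. Since each nonempty matching strictly decreases the number of cells, the sequence $\mathbb M^n(\mathcal K)$ stabilizes; $\mathbb M^\infty(\mathcal K)$ is the stable value. **Persistence intervals.** For $i\le j$ let $\beta_p^{i,j}$ be the rank of the inclusion-induced map $H_p(\mathcal K_i)\to H_p(\mathcal K_j)$ (homology over $F$). The multiset of $p$-dimensional persistence intervals of $\mathcal K$ contains, for $i<j$, the interval $[i,j]$ with multiplicity $(\beta_p^{i,j-1}-\beta_p^{i-1,j-1})-(\beta_p^{i,j}-\beta_p^{i-1,j})$,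 and $[i,\infty]$ with multiplicity $\beta_p^{i,N}-\beta_p^{i-1,N}$, where $N$ is the maximum value of $g$. **Cells starting and terminating intervals.** Let $c_1,\dots,c_n$ be the cells of a filtered complex listed so that $g(c_1)\le\dots\le g(c_n)$ and every face of a cell precedes it. (In $\mathbb M^\infty(\mathcal K)$ every face of a cell has strictly smaller $g$ than the cell.) Form the matrix whose $j$-th column is $\partial c_j$ (row $i$ corresponding to $c_i$). For a nonzero column let $low(j)$ be the largest row index of a nonzero entry of column $j$. The standard reduction processes $j=1,\dots,n$; while there is a nonzero column $k<j$ with $low(k)=low(j)$, it adds the multiple of column $k$ to column $j$ that cancels the entry in row $low(j)$ (over $\mathbb Z_2$: adds column $k$). In the reduced matrix, if column $j$ is nonzero and $k=low(j)$, then $c_k$ starts and $c_j$ terminates the interval $[g(c_k),g(c_j)]$, of length $g(c_j)-g(c_k)$; if column $i$ is zero and $i\ne low(j)$ for all $j$, then $c_i$ starts the interval $[g(c_i),\infty]$, of infinite length. *)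

theory Defs
  imports
    "HOL-Algebra.AbelCoset"
    "Jordan_Normal_Form.VS_Connect"
    "HOL-Library.While_Combinator"
    "HOL-Library.Extended_Real"
    "HOL-Library.Multiset"
begin

hide_const (open) Multiset.mult

section \<open>Finite filtered chain complexes\<close>

text \<open>
  \<open>inc K A b\<close> is the incidence index \<open>\<kappa>(A, b)\<close> of \<open>A\<close> with the lower-dimensional cell \<open>b\<close>. It is
  required below to vanish off the cells; \<open>cell_dim\<close> and \<open>filt\<close> are unconstrained there, and no
  operation on complexes changes them.
\<close>

record ('c, 'f) cell_complex =
  cells :: "'c set"
  cell_dim :: "'c \<Rightarrow> nat"
  inc :: "'c \<Rightarrow> 'c \<Rightarrow> 'f"
  filt :: "'c \<Rightarrow> int"

text \<open>
  A \<open>p\<close>-chain is a function on all of \<open>'c\<close> that vanishes off the \<open>p\<close>-cells. The multiplicative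
  fields of the record are meaningless, as is usual for modules in HOL-Algebra.
\<close>

definition chains :: "('c, 'f::field) cell_complex \<Rightarrow> nat \<Rightarrow> ('f, 'c \<Rightarrow> 'f) module" where
  "chains K p =
    \<lparr>carrier = {x. \<forall>A. x A \<noteq> 0 \<longrightarrow> A \<in> cells K \<and> cell_dim K A = p},
     mult = undefined, one = undefined,
     zero = (\<lambda>A. 0), add = (\<lambda>x y A. x A + y A), smult = (\<lambda>k x A. k * x A)\<rparr>"

definition boundary :: "('c, 'f::field) cell_complex \<Rightarrow> ('c \<Rightarrow> 'f) \<Rightarrow> 'c \<Rightarrow> 'f" where
  "boundary K x = (\<lambda>b. \<Sum>A\<in>cells K. x A * inc K A b)"

definition face :: "('c, 'f::field) cell_complex \<Rightarrow> 'c \<Rightarrow> 'c \<Rightarrow> bool" where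
  "face K b A \<longleftrightarrow> inc K A b \<noteq> 0"

locale filtered_chain_complex =
  fixes K :: "('c, 'f::field) cell_complex"
  assumes finite_cells: "finite (cells K)"
    and inc_nonzero:
      "inc K A b \<noteq> 0 \<Longrightarrow> A \<in> cells K \<and> b \<in> cells K \<and> cell_dim K A = cell_dim K b + 1"
    and boundary_boundary:
      "x \<in> carrier (chains K p) \<Longrightarrow> boundary K (boundary K x) = (\<lambda>b. 0)"
    and filt_face: "face K b A \<Longrightarrow> filt K b \<le> filt K A"

definition sublevel :: "('c, 'f::field) cell_complex \<Rightarrow> int \<Rightarrow> ('c, 'f) cell_complex" where
  "sublevel K t =
    (let S = {A \<in> cells K. filt K A \<le> t}
     in K\<lparr>cells := S, inc := (\<lambda>A b. if A \<in> S \<and> b \<in> S then inc K A b else 0)\<rparr>)"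

section \<open>Acyclic matchings and Morse complexes\<close>

definition matching :: "('c, 'f::field) cell_complex \<Rightarrow> ('c \<times> 'c) set \<Rightarrow> bool" where
  "matching K M \<longleftrightarrow>
    (\<forall>(A, b) \<in> M. A \<in> cells K \<and> b \<in> cells K \<and> inc K A b \<noteq> 0) \<and>
    (\<forall>(A, b) \<in> M. \<forall>(A', b') \<in> M. (A, b) \<noteq> (A', b') \<longrightarrow> {A, b} \<inter> {A', b'} = {})"

definition down_edges :: "('c, 'f::field) cell_complex \<Rightarrow> ('c \<times> 'c) set \<Rightarrow> ('c \<times> 'c) set" where
  "down_edges K M = {(A, b). A \<in> cells K \<and> b \<in> cells K \<and> inc K A b \<noteq> 0 \<and> (A, b) \<notin> M}"

definition morse_graph :: "('c, 'f::field) cell_complex \<Rightarrow> ('c \<times> 'c) set \<Rightarrow> ('c \<times> 'c) set" where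
  "morse_graph K M = down_edges K M \<union> M\<inverse>"

definition acyclic_matching :: "('c, 'f::field) cell_complex \<Rightarrow> ('c \<times> 'c) set \<Rightarrow> bool" where
  "acyclic_matching K M \<longleftrightarrow> matching K M \<and> acyclic (morse_graph K M)"

definition compatible :: "('c, 'f::field) cell_complex \<Rightarrow> ('c \<times> 'c) set \<Rightarrow> bool" where
  "compatible K M \<longleftrightarrow> (\<forall>(A, b) \<in> M. filt K A = filt K b)"

definition critical :: "('c, 'f::field) cell_complex \<Rightarrow> ('c \<times> 'c) set \<Rightarrow> 'c set" where
  "critical K M = cells K - (fst ` M \<union> snd ` M)"

text \<open>
  The path \<open>s = A\<^sub>0 \<rightarrow> a\<^sub>1 \<rightarrow> A\<^sub>1 \<rightarrow> \<dots> \<rightarrow> a\<^sub>k \<rightarrow> A\<^sub>k \<rightarrow> c\<close> is encoded by the list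
  \<open>ps = [(A\<^sub>1, a\<^sub>1), \<dots>, (A\<^sub>k, a\<^sub>k)]\<close> of its matched pairs. Then \<open>path_top s ps i\<close> is \<open>A\<^sub>i\<close> for
  \<open>i \<le> k\<close>, and \<open>path_bot ps c i\<close> is \<open>a\<^sub>i\<close> for \<open>1 \<le> i \<le> k + 1\<close>, with \<open>a\<^sub>k\<^sub>+\<^sub>1 = c\<close>.
\<close>

definition path_top :: "'c \<Rightarrow> ('c \<times> 'c) list \<Rightarrow> nat \<Rightarrow> 'c" where
  "path_top s ps i = (s # map fst ps) ! i"

definition path_bot :: "('c \<times> 'c) list \<Rightarrow> 'c \<Rightarrow> nat \<Rightarrow> 'c" where
  "path_bot ps c i = (map snd ps @ [c]) ! (i - 1)"

definition morse_path ::
  "('c, 'f::field) cell_complex \<Rightarrow> ('c \<times> 'c) set \<Rightarrow> 'c \<Rightarrow> ('c \<times> 'c) list \<Rightarrow> 'c \<Rightarrow> bool" where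
  "morse_path K M s ps c \<longleftrightarrow>
    set ps \<subseteq> M \<and>
    (\<forall>i \<in> {0..length ps}. (path_top s ps i, path_bot ps c (i + 1)) \<in> down_edges K M)"

definition path_weight ::
  "('c, 'f::field) cell_complex \<Rightarrow> 'c \<Rightarrow> ('c \<times> 'c) list \<Rightarrow> 'c \<Rightarrow> 'f" where
  "path_weight K s ps c =
    (-1) ^ length ps * inc K (path_top s ps 0) (path_bot ps c 1) *
    (\<Prod>i = 1..length ps.
      inverse (inc K (path_top s ps i) (path_bot ps c i)) *
      inc K (path_top s ps i) (path_bot ps c (i + 1)))"

text \<open>The set of paths is finite whenever \<open>M\<close> is an acyclic matching of a finite complex.\<close>

definition morse_complex ::
  "('c, 'f::field) cell_complex \<Rightarrow> ('c \<times> 'c) set \<Rightarrow> ('c, 'f) cell_complex" where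
  "morse_complex K M =
    K\<lparr>cells := critical K M,
      inc := (\<lambda>s c.
        if s \<in> critical K M \<and> c \<in> critical K M \<and> cell_dim K s = cell_dim K c + 1
        then \<Sum>ps | morse_path K M s ps c. path_weight K s ps c
        else 0)\<rparr>"

definition vital_morse_construction ::
  "(('c, 'f::field) cell_complex \<Rightarrow> ('c, 'f) cell_complex) \<Rightarrow> bool" where
  "vital_morse_construction \<M> \<longleftrightarrow>
    (\<forall>K. filtered_chain_complex K \<longrightarrow>
      (\<exists>M. acyclic_matching K M \<and> compatible K M \<and> \<M> K = morse_complex K M \<and>
        ((\<exists>A \<in> cells K. \<exists>b \<in> cells K. inc K A b \<noteq> 0 \<and> filt K A = filt K b) \<longrightarrow> M \<noteq> {})))"

text \<open>The stable value of \<open>K, \<M> K, \<M> (\<M> K), \<dots>\<close>.\<close>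

definition morse_limit ::
  "(('c, 'f::field) cell_complex \<Rightarrow> ('c, 'f) cell_complex) \<Rightarrow>
    ('c, 'f) cell_complex \<Rightarrow> ('c, 'f) cell_complex" where
  "morse_limit \<M> K = (THE L. \<forall>\<^sub>F n in sequentially. (\<M> ^^ n) K = L)"

section \<open>Persistent homology\<close>

definition cycles :: "('c, 'f::field) cell_complex \<Rightarrow> nat \<Rightarrow> ('c \<Rightarrow> 'f) set" where
  "cycles K p = {x \<in> carrier (chains K p). boundary K x = (\<lambda>b. 0)}"

definition boundaries :: "('c, 'f::field) cell_complex \<Rightarrow> nat \<Rightarrow> ('c \<Rightarrow> 'f) set" where
  "boundaries K p = boundary K ` carrier (chains K (p + 1))"

text \<open>
  The quotient of the module \<open>V\<close> by the submodule \<open>W\<close>, on cosets. In the scalar multiplication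
  the summand \<open>W\<close> only matters for the scalar zero, where it turns \<open>{\<zero>}\<close> into the zero coset.
\<close>

definition quotient_module :: "('a, 'v) module \<Rightarrow> 'v set \<Rightarrow> ('a, 'v set) module" where
  "quotient_module V W =
    \<lparr>carrier = a_rcosets\<^bsub>V\<^esub> W,
     mult = undefined, one = undefined,
     zero = W, add = (\<lambda>X Y. X <+>\<^bsub>V\<^esub> Y),
     smult = (\<lambda>k X. ((\<lambda>v. k \<odot>\<^bsub>V\<^esub> v) ` X) <+>\<^bsub>V\<^esub> W)\<rparr>"

definition homology :: "('c, 'f::field) cell_complex \<Rightarrow> nat \<Rightarrow> ('f, ('c \<Rightarrow> 'f) set) module" where
  "homology K p = quotient_module ((chains K p)\<lparr>carrier := cycles K p\<rparr>) (boundaries K p)"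

text \<open>
  For a subcomplex of \<open>L\<close>, the class \<open>z + B\<close> of a cycle \<open>z\<close> is sent to \<open>z + B + B' = z + B'\<close>, where
  \<open>B \<subseteq> B'\<close> are the boundaries in the subcomplex and in \<open>L\<close>.
\<close>

definition inclusion_homology ::
  "('c, 'f::field) cell_complex \<Rightarrow> nat \<Rightarrow> ('c \<Rightarrow> 'f) set \<Rightarrow> ('c \<Rightarrow> 'f) set" where
  "inclusion_homology L p X = X <+>\<^bsub>chains L p\<^esub> boundaries L p"

definition linear_rank ::
  "('f::field, 'v) module \<Rightarrow> ('f, 'w) module \<Rightarrow> ('v \<Rightarrow> 'w) \<Rightarrow> nat" where
  "linear_rank V W T = vectorspace.dim class_ring (W\<lparr>carrier := T ` carrier V\<rparr>)"

definition persistent_betti ::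
  "('c, 'f::field) cell_complex \<Rightarrow> nat \<Rightarrow> int \<Rightarrow> int \<Rightarrow> nat" where
  "persistent_betti K p i j =
    linear_rank (homology (sublevel K i) p) (homology (sublevel K j) p)
      (inclusion_homology (sublevel K j) p)"

datatype interval = Bounded_Interval int int | Unbounded_Interval int

fun interval_multiplicity ::
  "('c, 'f::field) cell_complex \<Rightarrow> nat \<Rightarrow> interval \<Rightarrow> int" where
  "interval_multiplicity K p (Bounded_Interval i j) =
    (let \<beta> = (\<lambda>i j. int (persistent_betti K p i j))
     in if i < j then (\<beta> i (j - 1) - \<beta> (i - 1) (j - 1)) - (\<beta> i j - \<beta> (i - 1) j) else 0)"
| "interval_multiplicity K p (Unbounded_Interval i) =
    (let \<beta> = (\<lambda>i j. int (persistent_betti K p i j)); N = Max (filt K ` cells K)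
     in \<beta> i N - \<beta> (i - 1) N)"

text \<open>
  For a filtered chain complex the multiplicities are nonnegative, so \<open>nat\<close> only changes their
  type; that they have finite support is part of \<open>count_persistence_intervals\<close> below.
\<close>

definition persistence_intervals ::
  "('c, 'f::field) cell_complex \<Rightarrow> nat \<Rightarrow> interval multiset" where
  "persistence_intervals K p = Abs_multiset (\<lambda>I. nat (interval_multiplicity K p I))"

lemma sublevel_pred:
  assumes "i \<notin> filt K ` cells K"
  shows "sublevel K (i - 1) = sublevel K i"
proof -
  have "{A \<in> cells K. filt K A \<le> i - 1} = {A \<in> cells K. filt K A \<le> i}"
    using assms by (force simp: image_iff)
  then show ?thesis by (simp only: sublevel_def)
qed

lemma count_persistence_intervals:
  assumes "finite (cells K)"
  shows "count (persistence_intervals K p) I = nat (interval_multiplicity K p I)"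
proof -
  define S where "S = filt K ` cells K"
  have "{I. 0 < nat (interval_multiplicity K p I)} \<subseteq>
    (\<lambda>(i, j). Bounded_Interval i j) ` (S \<times> S) \<union> Unbounded_Interval ` S"
  proof
    fix I assume "I \<in> {I. 0 < nat (interval_multiplicity K p I)}"
    then have pos: "0 < interval_multiplicity K p I" by simp
    show "I \<in> (\<lambda>(i, j). Bounded_Interval i j) ` (S \<times> S) \<union> Unbounded_Interval ` S"
    proof (cases I)
      case (Bounded_Interval i j)
      have "i \<in> S"
        using pos sublevel_pred[of i K]
        by (rule_tac ccontr) (simp add: Bounded_Interval S_def persistent_betti_def split: if_splits)
      moreover have "j \<in> S"
        using pos sublevel_pred[of j K]
        by (rule_tac ccontr) (simp add: Bounded_Interval S_def persistent_betti_def split: if_splits)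
      ultimately show ?thesis using Bounded_Interval by force
    next
      case (Unbounded_Interval i)
      have "i \<in> S"
        using pos sublevel_pred[of i K]
        by (rule_tac ccontr) (simp add: Unbounded_Interval S_def persistent_betti_def Let_def)
      then show ?thesis using Unbounded_Interval by simp
    qed
  qed
  moreover have "finite S" using assms by (simp add: S_def)
  ultimately have "finite {I. 0 < nat (interval_multiplicity K p I)}"
    by (meson finite_SigmaI finite_UnI finite_imageI finite_subset)
  then show ?thesis
    unfolding persistence_intervals_def by (simp add: count_Abs_multiset)
qed

section \<open>Cells starting and terminating intervals\<close>

definition admissible_listing :: "('c, 'f::field) cell_complex \<Rightarrow> 'c list \<Rightarrow> bool" where
  "admissible_listing K cs \<longleftrightarrow>
    distinct cs \<and> set cs = cells K \<and> sorted (map (filt K) cs) \<and>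
    (\<forall>i < length cs. \<forall>j < length cs. face K (cs ! i) (cs ! j) \<longrightarrow> i < j)"

lemma (in filtered_chain_complex) admissible_listing_exists: "\<exists>cs. admissible_listing K cs"
proof -
  define N where "N = int (\<Sum>A\<in>cells K. cell_dim K A) + 1"
  define key where "key A = filt K A * N + int (cell_dim K A)" for A
  have dim: "int (cell_dim K A) < N" if "A \<in> cells K" for A
    using member_le_sum[OF that, of "cell_dim K"] finite_cells by (simp add: N_def del: of_nat_sum)
  obtain xs where xs: "set xs = cells K" "distinct xs"
    using finite_distinct_list[OF finite_cells] by blast
  define cs where "cs = sort_key key xs"
  have cs: "distinct cs" "set cs = cells K" "sorted (map key cs)"
    using xs by (simp_all add: cs_def)
  have filt_mono: "filt K A \<le> filt K B" if "key A \<le> key B" "B \<in> cells K" for A B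
  proof (rule ccontr)
    assume "\<not> filt K A \<le> filt K B"
    then have "(filt K B + 1) * N \<le> filt K A * N"
      by (intro mult_right_mono) (auto simp: N_def simp del: of_nat_sum)
    then show False using that(1) dim[OF that(2)] by (simp add: key_def distrib_right)
  qed
  have "sorted (map (filt K) cs)"
    using cs filt_mono nth_mem[of _ cs] by (simp add: sorted_iff_nth_mono)
  moreover have "i < j"
    if ij: "i < length cs" "j < length cs" and f: "face K (cs ! i) (cs ! j)" for i j
  proof (rule ccontr)
    assume "\<not> i < j"
    then have le: "key (cs ! j) \<le> key (cs ! i)"
      using cs(3) ij by (auto simp: sorted_iff_nth_mono)
    have "filt K (cs ! i) * N \<le> filt K (cs ! j) * N"
      using filt_face[OF f] by (intro mult_right_mono) (auto simp: N_def simp del: of_nat_sum)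
    moreover have "cell_dim K (cs ! j) = cell_dim K (cs ! i) + 1"
      using f inc_nonzero by (simp add: face_def)
    ultimately show False using le by (simp add: key_def)
  qed
  ultimately show ?thesis using cs by (auto simp: admissible_listing_def)
qed

text \<open>Columns are boundaries: the entry in row \<open>i\<close> and column \<open>j\<close> is \<open>\<kappa>(c\<^sub>j, c\<^sub>i)\<close>.\<close>

definition boundary_matrix :: "('c, 'f::field) cell_complex \<Rightarrow> 'c list \<Rightarrow> 'f mat" where
  "boundary_matrix K cs = mat (length cs) (length cs) (\<lambda>(i, j). inc K (cs ! j) (cs ! i))"

definition nonzero_col :: "'f::field mat \<Rightarrow> nat \<Rightarrow> bool" where
  "nonzero_col R j \<longleftrightarrow> (\<exists>i < dim_row R. R $$ (i, j) \<noteq> 0)"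

definition low :: "'f::field mat \<Rightarrow> nat \<Rightarrow> nat" where
  "low R j = Max {i. i < dim_row R \<and> R $$ (i, j) \<noteq> 0}"

definition low_clash :: "nat \<Rightarrow> 'f::field mat \<Rightarrow> nat \<Rightarrow> bool" where
  "low_clash j R k \<longleftrightarrow> k < j \<and> nonzero_col R k \<and> nonzero_col R j \<and> low R k = low R j"

text \<open>
  When column \<open>j\<close> is processed, the columns \<open>k < j\<close> are already reduced and have pairwise distinct
  lows, so the clashing column chosen by \<open>LEAST\<close> is the only one.
\<close>

definition cancel_low :: "nat \<Rightarrow> 'f::field mat \<Rightarrow> 'f mat" where
  "cancel_low j R =
    (let k = (LEAST k. low_clash j R k); l = low R j
     in addcol (- (R $$ (l, j) / R $$ (l, k))) j k R)"

definition reduce_col :: "nat \<Rightarrow> 'f::field mat \<Rightarrow> 'f mat" where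
  "reduce_col j R = while (\<lambda>R. \<exists>k. low_clash j R k) (cancel_low j) R"

definition standard_reduction :: "'f::field mat \<Rightarrow> 'f mat" where
  "standard_reduction R = fold reduce_col [0..<dim_col R] R"

definition starts_interval ::
  "('c, 'f::field) cell_complex \<Rightarrow> 'c list \<Rightarrow> 'c \<Rightarrow> interval \<Rightarrow> bool" where
  "starts_interval K cs A I \<longleftrightarrow>
    (let R = standard_reduction (boundary_matrix K cs) in
      (\<exists>j < length cs. nonzero_col R j \<and> A = cs ! low R j \<and>
        I = Bounded_Interval (filt K (cs ! low R j)) (filt K (cs ! j))) \<or>
      (\<exists>i < length cs. \<not> nonzero_col R i \<and> (\<forall>j < length cs. nonzero_col R j \<longrightarrow> i \<noteq> low R j) \<and>
        A = cs ! i \<and> I = Unbounded_Interval (filt K (cs ! i))))"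

definition terminates_interval ::
  "('c, 'f::field) cell_complex \<Rightarrow> 'c list \<Rightarrow> 'c \<Rightarrow> interval \<Rightarrow> bool" where
  "terminates_interval K cs A I \<longleftrightarrow>
    (let R = standard_reduction (boundary_matrix K cs) in
      \<exists>j < length cs. nonzero_col R j \<and> A = cs ! j \<and>
        I = Bounded_Interval (filt K (cs ! low R j)) (filt K (cs ! j)))"

fun interval_length :: "interval \<Rightarrow> ereal" where
  "interval_length (Bounded_Interval i j) = ereal (of_int (j - i))"
| "interval_length (Unbounded_Interval i) = \<infinity>"

end

(*
  Let M be an acyclic matching with matched tops P, matched bottoms Q and critical cells C. Acyclicity
  makes the part of the boundary operator that goes from P to Q triangular, hence invertible; its
  inverse D, extended by 0, is a homotopy with (bd D x) = x on Q and D bd y = y for y supported on P.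
  Thus pi = 1 - bd D - D bd is an idempotent chain map that respects the filtration and is chain
  homotopic to the identity, and the chains of the Morse complex are identified with the image of pi
  by restriction to C. The path sums defining the Morse incidence satisfy a first-step recursion,
  which says that they are the entries of the Schur complement, that is, of bd pi on C. This gives
  correctness for one step. In the limit no cell has a face of the same filtration value, and the
  reduction of the boundary matrix preserves this strictness, so no interval of length 0 is paired.
*)
theory Submission
  imports Defs "HOL-Library.Function_Algebras"
begin

section \<open>Linear algebra\<close>

text \<open>The rank of the map from level i to level j is the dimension of the cycles at level i
  modulo those that bound at level j. Correctness therefore reduces to one linear map, pi followed
  by restriction to C: it must send cycles onto cycles at level i and detect bounding at level j. D
  stays inside every sublevel because a matched pair has a single filtration value and faces never
  raise it. The obstacle is that the path sums are combinatorial while D comes from back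
  substitution. D is not expanded into paths. Instead, the path sums starting at tops, divided by
  the matched incidences, express the boundary of any chain over P at a cell of C through its values
  on Q. Applied to D x, a chain over P whose boundary on Q is x, this turns the path recursion into
  the Schur complement. For optimality, strict inequality between the filtration values of a face
  and its cell comes from vitality: the iteration stops at an empty matching, which vitality permits
  only when no face shares the value of its cell.\<close>

lemma vectorspace_class_ringI:
  fixes V :: "('f::field, 'v, 'z) module_scheme"
  assumes "abelian_group V"
    and "\<And>k v. v \<in> carrier V \<Longrightarrow> k \<odot>\<^bsub>V\<^esub> v \<in> carrier V"
    and "\<And>k l v. v \<in> carrier V \<Longrightarrow> (k + l) \<odot>\<^bsub>V\<^esub> v = k \<odot>\<^bsub>V\<^esub> v \<oplus>\<^bsub>V\<^esub> l \<odot>\<^bsub>V\<^esub> v"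
    and "\<And>k v w. v \<in> carrier V \<Longrightarrow> w \<in> carrier V \<Longrightarrow>
      k \<odot>\<^bsub>V\<^esub> (v \<oplus>\<^bsub>V\<^esub> w) = k \<odot>\<^bsub>V\<^esub> v \<oplus>\<^bsub>V\<^esub> k \<odot>\<^bsub>V\<^esub> w"
    and "\<And>k l v. v \<in> carrier V \<Longrightarrow> (k * l) \<odot>\<^bsub>V\<^esub> v = k \<odot>\<^bsub>V\<^esub> (l \<odot>\<^bsub>V\<^esub> v)"
    and "\<And>v. v \<in> carrier V \<Longrightarrow> 1 \<odot>\<^bsub>V\<^esub> v = v"
  shows "vectorspace class_ring V"
proof -
  have "Module.module class_ring V"
    by (rule moduleI) (use assms class_cring.is_cring in auto)
  then show ?thesis
    unfolding vectorspace_def using class_field.field_axioms by auto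
qed

text \<open>\<open>linear_rank\<close> takes the dimension of a bare record, so \<open>W\<close>
  starts without any axioms and each one is pulled back to preimages in \<open>V\<close>.
  Preservation of zero is a hypothesis because it follows from additivity only once \<open>W\<close>
  is known to be a group.\<close>

lemma surjective_image_vectorspace:
  fixes V :: "('f::field, 'v, 'z) module_scheme" and W :: "('f, 'w, 'y) module_scheme"
  assumes V: "vectorspace class_ring V"
    and surj: "T ` carrier V = carrier W"
    and add: "\<And>v w. v \<in> carrier V \<Longrightarrow> w \<in> carrier V \<Longrightarrow> T (v \<oplus>\<^bsub>V\<^esub> w) = T v \<oplus>\<^bsub>W\<^esub> T w"
    and smult: "\<And>k v. v \<in> carrier V \<Longrightarrow> T (k \<odot>\<^bsub>V\<^esub> v) = k \<odot>\<^bsub>W\<^esub> T v"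
    and zero: "T \<zero>\<^bsub>V\<^esub> = \<zero>\<^bsub>W\<^esub>"
  shows "vectorspace class_ring W"
proof -
  interpret V: vectorspace class_ring V by fact
  have ab: "abelian_group W"
  proof (rule abelian_groupI)
    fix x y assume "x \<in> carrier W" "y \<in> carrier W"
    then obtain v w where vw: "v \<in> carrier V" "w \<in> carrier V" "x = T v" "y = T w"
      using surj by blast
    then show "x \<oplus>\<^bsub>W\<^esub> y \<in> carrier W"
      using surj by (metis add V.M.add.m_closed imageI)
    show "x \<oplus>\<^bsub>W\<^esub> y = y \<oplus>\<^bsub>W\<^esub> x"
      using vw by (metis add V.M.add.m_comm)
    fix z assume "z \<in> carrier W"
    then obtain u where u: "u \<in> carrier V" "z = T u" using surj by blast
    show "x \<oplus>\<^bsub>W\<^esub> y \<oplus>\<^bsub>W\<^esub> z = x \<oplus>\<^bsub>W\<^esub> (y \<oplus>\<^bsub>W\<^esub> z)"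
      using vw u by (simp flip: add add: V.M.add.m_assoc)
  next
    show "\<zero>\<^bsub>W\<^esub> \<in> carrier W" using zero surj by (metis V.M.zero_closed imageI)
  next
    fix x assume "x \<in> carrier W"
    then obtain v where v: "v \<in> carrier V" "x = T v" using surj by blast
    then show "\<zero>\<^bsub>W\<^esub> \<oplus>\<^bsub>W\<^esub> x = x" by (metis zero add V.M.zero_closed V.M.l_zero)
    have "T (\<ominus>\<^bsub>V\<^esub> v) \<oplus>\<^bsub>W\<^esub> x = \<zero>\<^bsub>W\<^esub>"
      using v by (metis zero add V.M.a_inv_closed V.M.l_neg)
    moreover have "T (\<ominus>\<^bsub>V\<^esub> v) \<in> carrier W" using v surj by blast
    ultimately show "\<exists>y\<in>carrier W. y \<oplus>\<^bsub>W\<^esub> x = \<zero>\<^bsub>W\<^esub>" by blast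
  qed
  have V_smult: "k \<odot>\<^bsub>V\<^esub> v \<in> carrier V" if "v \<in> carrier V" for k v
    using that by simp
  show ?thesis
  proof (rule vectorspace_class_ringI[OF ab])
    fix k l :: 'f and x assume "x \<in> carrier W"
    then obtain v where v: "v \<in> carrier V" "x = T v" using surj by blast
    show "k \<odot>\<^bsub>W\<^esub> x \<in> carrier W"
      using v V_smult surj by (metis smult imageI)
    show "(k + l) \<odot>\<^bsub>W\<^esub> x = k \<odot>\<^bsub>W\<^esub> x \<oplus>\<^bsub>W\<^esub> l \<odot>\<^bsub>W\<^esub> x"
      using v V_smult V.smult_l_distr[of k l v] by (simp flip: smult add)
    show "(k * l) \<odot>\<^bsub>W\<^esub> x = k \<odot>\<^bsub>W\<^esub> (l \<odot>\<^bsub>W\<^esub> x)"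
      using v V_smult V.smult_assoc1[of k l v] by (simp flip: smult)
    show "1 \<odot>\<^bsub>W\<^esub> x = x"
      using v V.smult_one[of v] by (simp flip: smult)
    fix y assume "y \<in> carrier W"
    then obtain w where w: "w \<in> carrier V" "y = T w" using surj by blast
    show "k \<odot>\<^bsub>W\<^esub> (x \<oplus>\<^bsub>W\<^esub> y) = k \<odot>\<^bsub>W\<^esub> x \<oplus>\<^bsub>W\<^esub> k \<odot>\<^bsub>W\<^esub> y"
      using v w V_smult V.smult_r_distr[of k v w] by (simp flip: smult add)
  qed
qed

lemma bijective_linear_map_dim:
  assumes "linear_map R V W T" and bij: "bij_betw T (carrier V) (carrier W)"
  shows "vectorspace.dim R V = vectorspace.dim R W"
proof -
  interpret linear_map R V W T by fact
  have inj: "inj_on T (carrier V)" and surj: "T ` carrier V = carrier W"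
    using bij by (auto simp: bij_betw_def)
  define S where "S = inv_into (carrier V) T"
  have TS: "T (S w) = w" "S w \<in> carrier V" if "w \<in> carrier W" for w
    using that surj by (auto simp: S_def f_inv_into_f inv_into_into)
  have ST: "S (T v) = v" if "v \<in> carrier V" for v
    using that inj by (simp add: S_def)
  have "S \<in> LinearCombinations.module_hom R W V"
    unfolding LinearCombinations.module_hom_def
  proof (intro CollectI conjI allI impI)
    show "S \<in> carrier W \<rightarrow> carrier V" using TS(2) by blast
    fix w w' assume "w \<in> carrier W \<and> w' \<in> carrier W"
    then show "S (w \<oplus>\<^bsub>W\<^esub> w') = S w \<oplus>\<^bsub>V\<^esub> S w'"
      using ST[of "S w \<oplus>\<^bsub>V\<^esub> S w'"] by (simp add: TS)
  next
    fix k w assume "k \<in> carrier R \<and> w \<in> carrier W"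
    then show "S (k \<odot>\<^bsub>W\<^esub> w) = k \<odot>\<^bsub>V\<^esub> S w"
      using ST[of "k \<odot>\<^bsub>V\<^esub> S w"] by (simp add: TS)
  qed
  then interpret S: linear_map R W V S
    by unfold_locales
  have S_surj: "S ` carrier W = carrier V"
    using TS(2) ST surj by (metis (no_types, lifting) image_eqI image_subsetI subsetI subset_antisym)
  show ?thesis
  proof (cases "V.fin_dim")
    case True
    then show ?thesis by (rule dim_eq[OF _ inj surj])
  next
    case False
    then have "\<not> W.fin_dim" using S.surj_fin_dim[OF _ S_surj] by blast
    with False have no_gen: "\<not> (finite A \<and> card A = n \<and> A \<subseteq> carrier V \<and> V.module.span A = carrier V)"
        "\<not> (finite B \<and> card B = n \<and> B \<subseteq> carrier W \<and> W.module.span B = carrier W)" for A B n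
      unfolding V.fin_dim_def W.fin_dim_def by blast+
    \<comment> \<open>Both dimensions are \<open>LEAST\<close> of a predicate that no number
      satisfies, hence the same unspecified value.\<close>
    show ?thesis unfolding V.dim_def W.dim_def by (simp only: no_gen simp_thms)
  qed
qed

text \<open>Both targets are \<open>V\<close> modulo the same kernel. In this way images inside
  unrelated homology modules are compared through one space of cycles above them.\<close>

lemma dim_eq_if_same_fibres:
  fixes V :: "('f::field, 'v, 'z) module_scheme"
    and W :: "('f, 'w, 'y) module_scheme" and W' :: "('f, 'u, 'x) module_scheme"
  assumes V: "vectorspace class_ring V"
    and T: "T ` carrier V = carrier W"
      "\<And>v w. v \<in> carrier V \<Longrightarrow> w \<in> carrier V \<Longrightarrow> T (v \<oplus>\<^bsub>V\<^esub> w) = T v \<oplus>\<^bsub>W\<^esub> T w"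
      "\<And>k v. v \<in> carrier V \<Longrightarrow> T (k \<odot>\<^bsub>V\<^esub> v) = k \<odot>\<^bsub>W\<^esub> T v"
      "T \<zero>\<^bsub>V\<^esub> = \<zero>\<^bsub>W\<^esub>"
    and S: "S ` carrier V = carrier W'"
      "\<And>v w. v \<in> carrier V \<Longrightarrow> w \<in> carrier V \<Longrightarrow> S (v \<oplus>\<^bsub>V\<^esub> w) = S v \<oplus>\<^bsub>W'\<^esub> S w"
      "\<And>k v. v \<in> carrier V \<Longrightarrow> S (k \<odot>\<^bsub>V\<^esub> v) = k \<odot>\<^bsub>W'\<^esub> S v"
      "S \<zero>\<^bsub>V\<^esub> = \<zero>\<^bsub>W'\<^esub>"
    and fibres: "\<And>v w. v \<in> carrier V \<Longrightarrow> w \<in> carrier V \<Longrightarrow> T v = T w \<longleftrightarrow> S v = S w"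
  shows "vectorspace.dim class_ring W = vectorspace.dim class_ring W'"
proof -
  interpret V: vectorspace class_ring V by fact
  interpret W: vectorspace class_ring W
    by (rule surjective_image_vectorspace[OF V T])
  interpret W': vectorspace class_ring W'
    by (rule surjective_image_vectorspace[OF V S])
  \<comment> \<open>\<open>U\<close> is meant to send \<open>T v\<close> to \<open>S v\<close>;
    equality of fibres makes the chosen preimage irrelevant.\<close>
  define U where "U = S \<circ> inv_into (carrier V) T"
  have UT: "U (T v) = S v" if "v \<in> carrier V" for v
    using that fibres[of "inv_into (carrier V) T (T v)" v]
    by (simp add: U_def f_inv_into_f inv_into_into)
  have lift: "\<exists>v \<in> carrier V. w = T v" if "w \<in> carrier W" for w
    using that T(1) by blast
  have "U \<in> LinearCombinations.module_hom class_ring W W'"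
    unfolding LinearCombinations.module_hom_def
  proof (intro CollectI conjI allI impI)
    show "U \<in> carrier W \<rightarrow> carrier W'"
    proof
      fix w assume "w \<in> carrier W"
      then obtain v where "v \<in> carrier V" "w = T v" using lift by blast
      then show "U w \<in> carrier W'" using UT S(1) by auto
    qed
    fix w w' assume "w \<in> carrier W \<and> w' \<in> carrier W"
    then obtain v v' where "v \<in> carrier V" "v' \<in> carrier V" "w = T v" "w' = T v'"
      using lift by metis
    then show "U (w \<oplus>\<^bsub>W\<^esub> w') = U w \<oplus>\<^bsub>W'\<^esub> U w'"
      using UT[of "v \<oplus>\<^bsub>V\<^esub> v'"] by (simp add: UT S T)
  next
    fix k :: 'f and w assume "k \<in> carrier class_ring \<and> w \<in> carrier W"
    then obtain v where "v \<in> carrier V" "w = T v" using lift by blast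
    then show "U (k \<odot>\<^bsub>W\<^esub> w) = k \<odot>\<^bsub>W'\<^esub> U w"
      using UT[of "k \<odot>\<^bsub>V\<^esub> v"] by (simp add: UT S T)
  qed
  then interpret U: linear_map class_ring W W' U by unfold_locales
  have "bij_betw U (carrier W) (carrier W')"
    unfolding bij_betw_def
  proof
    show "inj_on U (carrier W)"
      by (rule inj_onI) (metis lift UT fibres)
    show "U ` carrier W = carrier W'"
      unfolding T(1)[symmetric] S(1)[symmetric] using UT by force
  qed
  then show ?thesis
    by (rule bijective_linear_map_dim[OF U.linear_map_axioms])
qed


section \<open>Persistent Betti numbers\<close>

definition linearly_closed :: "('c \<Rightarrow> 'f::field) set \<Rightarrow> bool" where
  "linearly_closed U \<longleftrightarrow>
    0 \<in> U \<and> (\<forall>x \<in> U. \<forall>y \<in> U. x + y \<in> U) \<and> (\<forall>k. \<forall>x \<in> U. (\<lambda>A. k * x A) \<in> U)"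

lemma linearly_closedD:
  assumes "linearly_closed U"
  shows "0 \<in> U" "x \<in> U \<Longrightarrow> y \<in> U \<Longrightarrow> x + y \<in> U" "x \<in> U \<Longrightarrow> (\<lambda>A. k * x A) \<in> U"
    "x \<in> U \<Longrightarrow> y \<in> U \<Longrightarrow> x - y \<in> U"
proof -
  show add: "0 \<in> U" "x \<in> U \<Longrightarrow> y \<in> U \<Longrightarrow> x + y \<in> U" for x y
    using assms by (auto simp: linearly_closed_def)
  show smult: "x \<in> U \<Longrightarrow> (\<lambda>A. k * x A) \<in> U" for x k
    using assms by (auto simp: linearly_closed_def)
  assume "x \<in> U" "y \<in> U"
  moreover have "x - y = x + (\<lambda>A. - 1 * y A)" by (simp add: fun_eq_iff)
  ultimately show "x - y \<in> U" using add smult by metis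
qed

section \<open>Cosets of subspaces of functions, the elements of homology\<close>

abbreviation coset :: "('c \<Rightarrow> 'f::field) set \<Rightarrow> ('c \<Rightarrow> 'f) \<Rightarrow> ('c \<Rightarrow> 'f) set" where
  "coset B z \<equiv> (\<lambda>b. b + z) ` B"

lemma coset_eq_iff:
  assumes "linearly_closed B"
  shows "coset B z = coset B w \<longleftrightarrow> z - w \<in> B"
proof
  assume "coset B z = coset B w"
  then have "z \<in> coset B w"
    using linearly_closedD(1)[OF assms] by force
  then show "z - w \<in> B" by auto
next
  assume B: "z - w \<in> B"
  show "coset B z = coset B w"
  proof (intro equalityI subsetI)
    fix x assume "x \<in> coset B z"
    then obtain b where "b \<in> B" "x = (b + (z - w)) + w" by auto
    then show "x \<in> coset B w" using linearly_closedD(2)[OF assms _ B] by blast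
  next
    fix x assume "x \<in> coset B w"
    then obtain b where "b \<in> B" "x = (b - (z - w)) + z" by auto
    then show "x \<in> coset B z" using linearly_closedD(4)[OF assms _ B] by blast
  qed
qed

lemma chains_simps [simp]:
  "add (chains K p) = (+)" "zero (chains K p) = 0" "smult (chains K p) = (\<lambda>k x A. k * x A)"
  by (simp_all add: chains_def fun_eq_iff)

lemma set_add_chains: "X <+>\<^bsub>(chains K p)\<lparr>carrier := Z\<rparr>\<^esub> Y = {x + y |x y. x \<in> X \<and> y \<in> Y}"
  "X <+>\<^bsub>chains K p\<^esub> Y = {x + y |x y. x \<in> X \<and> y \<in> Y}"
  by (auto simp: set_add_def')

text \<open>The case \<open>B = C\<close> is addition in homology; the case \<open>w = 0\<close> is
  the map induced by an inclusion of complexes.\<close>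

lemma coset_add_coset:
  assumes "linearly_closed B" "linearly_closed C" "B \<subseteq> C"
  shows "{x + y |x y. x \<in> coset B z \<and> y \<in> coset C w} = coset C (z + w)"
proof (intro equalityI subsetI)
  fix u assume "u \<in> {x + y |x y. x \<in> coset B z \<and> y \<in> coset C w}"
  then obtain b c where "b \<in> B" "c \<in> C" "u = (b + c) + (z + w)"
    by (auto simp: add_ac)
  then show "u \<in> coset C (z + w)" using linearly_closedD(2)[OF assms(2)] assms(3) by blast
next
  fix u assume "u \<in> coset C (z + w)"
  then obtain c where "c \<in> C" "u = (0 + z) + (c + w)" by (auto simp: add_ac)
  then show "u \<in> {x + y |x y. x \<in> coset B z \<and> y \<in> coset C w}"
    using linearly_closedD(1)[OF assms(1)] by blast
qed

lemma coset_smult: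
  assumes "linearly_closed B"
  shows "{x + y |x y. x \<in> (\<lambda>v A. k * v A) ` coset B z \<and> y \<in> B} = coset B (\<lambda>A. k * z A)"
proof (intro equalityI subsetI)
  fix u assume "u \<in> {x + y |x y. x \<in> (\<lambda>v A. k * v A) ` coset B z \<and> y \<in> B}"
  then obtain b c where "b \<in> B" "c \<in> B" "u = ((\<lambda>A. k * b A) + c) + (\<lambda>A. k * z A)"
    by (auto simp: fun_eq_iff algebra_simps)
  then show "u \<in> coset B (\<lambda>A. k * z A)"
    using linearly_closedD(2,3)[OF assms] by blast
next
  fix u assume "u \<in> coset B (\<lambda>A. k * z A)"
  then obtain c where "c \<in> B" "u = (\<lambda>A. k * (0 + z) A) + c" by (auto simp: add_ac)
  then show "u \<in> {x + y |x y. x \<in> (\<lambda>v A. k * v A) ` coset B z \<and> y \<in> B}"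
    using linearly_closedD(1)[OF assms] by blast
qed

lemma carrier_homology: "carrier (homology K p) = coset (boundaries K p) ` cycles K p"
  by (auto simp: homology_def quotient_module_def A_RCOSETS_def' a_r_coset_def')

lemma homology_ops:
  "X \<oplus>\<^bsub>homology K p\<^esub> Y = {x + y |x y. x \<in> X \<and> y \<in> Y}"
  "k \<odot>\<^bsub>homology K p\<^esub> X = {x + y |x y. x \<in> (\<lambda>v A. k * v A) ` X \<and> y \<in> boundaries K p}"
  "\<zero>\<^bsub>homology K p\<^esub> = boundaries K p"
  by (simp_all add: homology_def quotient_module_def set_add_chains)

lemma vectorspace_linearly_closed:
  assumes "linearly_closed Z"
  shows "vectorspace class_ring ((chains K p)\<lparr>carrier := Z\<rparr>)"
proof (rule vectorspace_class_ringI)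
  show "abelian_group ((chains K p)\<lparr>carrier := Z\<rparr>)"
  proof (rule abelian_groupI)
    fix x assume "x \<in> carrier ((chains K p)\<lparr>carrier := Z\<rparr>)"
    then have "0 - x \<in> Z" by (auto intro!: linearly_closedD(1,4)[OF assms] simp del: diff_0)
    then show "\<exists>y\<in>carrier ((chains K p)\<lparr>carrier := Z\<rparr>).
        y \<oplus>\<^bsub>(chains K p)\<lparr>carrier := Z\<rparr>\<^esub> x = \<zero>\<^bsub>(chains K p)\<lparr>carrier := Z\<rparr>\<^esub>"
      by (intro bexI[of _ "0 - x"]) (auto simp del: diff_0)
  qed (use linearly_closedD[OF assms] in \<open>auto simp: add_ac\<close>)
qed (use linearly_closedD[OF assms] in \<open>auto simp: fun_eq_iff algebra_simps\<close>)

lemma linearly_closed_chains: "linearly_closed (carrier (chains K p))"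
  by (auto simp: linearly_closed_def chains_def) (metis add.left_neutral)+

lemma boundary_add: "boundary K (x + y) = boundary K x + boundary K y"
  by (simp add: boundary_def fun_eq_iff distrib_right sum.distrib)

lemma boundary_smult: "boundary K (\<lambda>A. k * x A) = (\<lambda>b. k * boundary K x b)"
  by (simp add: boundary_def fun_eq_iff sum_distrib_left mult_ac)

lemma boundary_zero: "boundary K 0 = 0"
  by (simp add: boundary_def fun_eq_iff)

lemma boundary_diff: "boundary K (x - y) = boundary K x - boundary K y"
  by (simp add: boundary_def fun_eq_iff left_diff_distrib sum_subtractf)

lemma linearly_closed_cycles: "linearly_closed (cycles K p)"
  using linearly_closed_chains[of K p] unfolding linearly_closed_def cycles_def
  by (simp add: boundary_add boundary_smult boundary_zero) (simp add: zero_fun_def)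

lemma linearly_closed_boundaries: "linearly_closed (boundaries K p)"
  unfolding linearly_closed_def boundaries_def
proof (intro conjI ballI allI)
  note closed = linearly_closedD[OF linearly_closed_chains[of K "p + 1"]]
  show "0 \<in> boundary K ` carrier (chains K (p + 1))"
    using closed(1) by (metis boundary_zero imageI)
  fix x assume "x \<in> boundary K ` carrier (chains K (p + 1))"
  then obtain u where u: "u \<in> carrier (chains K (p + 1))" "x = boundary K u" by blast
  show "(\<lambda>A. k * x A) \<in> boundary K ` carrier (chains K (p + 1))" for k
    unfolding u(2) boundary_smult[symmetric] by (rule imageI) (rule closed(3)[OF u(1)])
  fix y assume "y \<in> boundary K ` carrier (chains K (p + 1))"
  then obtain v where v: "v \<in> carrier (chains K (p + 1))" "y = boundary K v" by blast
  show "x + y \<in> boundary K ` carrier (chains K (p + 1))"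
    unfolding u(2) v(2) boundary_add[symmetric] by (rule imageI) (rule closed(2)[OF u(1) v(1)])
qed

lemmas coset_plus_coset =
  coset_add_coset[OF linearly_closed_boundaries linearly_closed_boundaries order_refl]

section \<open>Sublevel complexes and the rank of inclusions\<close>

lemma carrier_chains_sublevel:
  "x \<in> carrier (chains (sublevel K t) p) \<longleftrightarrow>
    (\<forall>A. x A \<noteq> 0 \<longrightarrow> A \<in> cells K \<and> filt K A \<le> t \<and> cell_dim K A = p)"
  by (auto simp: chains_def sublevel_def Let_def)

context filtered_chain_complex
begin

text \<open>Faces have no larger filtration value, so truncating the incidence to the sublevel loses
  no face of its cells.\<close>

lemma boundary_sublevel:
  assumes "x \<in> carrier (chains (sublevel K t) p)"
  shows "boundary (sublevel K t) x = boundary K x"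
proof
  fix b
  have "(\<Sum>A \<in> {A \<in> cells K. filt K A \<le> t}.
      x A * (if (A \<in> cells K \<and> filt K A \<le> t) \<and> b \<in> cells K \<and> filt K b \<le> t then inc K A b else 0)) =
    (\<Sum>A\<in>cells K. x A * inc K A b)"
  proof (rule sum.mono_neutral_cong_left)
    show "finite (cells K)" by (rule finite_cells)
    show "\<forall>A \<in> cells K - {A \<in> cells K. filt K A \<le> t}. x A * inc K A b = 0"
      using assms by (auto simp: carrier_chains_sublevel)
    fix A assume "A \<in> {A \<in> cells K. filt K A \<le> t}"
    then show "x A * (if (A \<in> cells K \<and> filt K A \<le> t) \<and> b \<in> cells K \<and> filt K b \<le> t
        then inc K A b else 0) = x A * inc K A b"
      using inc_nonzero[of A b] filt_face[of b A] by (force simp: face_def)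
  qed auto
  then show "boundary (sublevel K t) x b = boundary K x b"
    by (simp add: boundary_def sublevel_def Let_def)
qed

lemma cycles_sublevel:
  "x \<in> cycles (sublevel K t) p \<longleftrightarrow> x \<in> carrier (chains (sublevel K t) p) \<and> boundary K x = 0"
  by (auto simp: cycles_def boundary_sublevel zero_fun_def)

lemma boundaries_sublevel:
  "boundaries (sublevel K t) p = boundary K ` carrier (chains (sublevel K t) (p + 1))"
  unfolding boundaries_def by (rule image_cong[OF refl]) (rule boundary_sublevel)

lemma boundaries_sublevel_mono:
  assumes "i \<le> j"
  shows "boundaries (sublevel K i) p \<subseteq> boundaries (sublevel K j) p"
  unfolding boundaries_sublevel using assms
  by (intro image_mono) (force simp: carrier_chains_sublevel)

end

text \<open>The boundaries at level \<open>i\<close> are absorbed by those at level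
  \<open>j\<close>, so the cycles at level \<open>i\<close> parametrize the image directly.\<close>

lemma image_inclusion_homology:
  assumes "filtered_chain_complex K" "i \<le> j"
  shows "inclusion_homology (sublevel K j) p ` carrier (homology (sublevel K i) p) =
    coset (boundaries (sublevel K j) p) ` cycles (sublevel K i) p"
  using coset_add_coset[OF linearly_closed_boundaries linearly_closed_boundaries
      filtered_chain_complex.boundaries_sublevel_mono[OF assms], where w = 0]
  by (simp add: carrier_homology inclusion_homology_def set_add_chains image_image)

text \<open>Two cycles have the same image class exactly when their difference bounds at level
  \<open>j\<close>. Thus \<open>f\<close> may have a kernel, provided that it is onto the cycles and
  that bounding is preserved and reflected.\<close>

lemma persistent_betti_eq:
  fixes K :: "('c, 'f::field) cell_complex" and L :: "('d, 'f) cell_complex"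
  assumes K: "filtered_chain_complex K" and L: "filtered_chain_complex L" and le: "i \<le> j"
    and add: "\<And>x y. f (x + y) = f x + f y"
    and smult: "\<And>k x. f (\<lambda>A. k * x A) = (\<lambda>A. k * f x A)"
    and cycles: "f ` cycles (sublevel K i) p = cycles (sublevel L i) p"
    and boundaries: "\<And>z. z \<in> cycles (sublevel K i) p \<Longrightarrow>
      z \<in> boundaries (sublevel K j) p \<longleftrightarrow> f z \<in> boundaries (sublevel L j) p"
  shows "persistent_betti K p i j = persistent_betti L p i j"
proof -
  define V where "V = (chains (sublevel K i) p)\<lparr>carrier := cycles (sublevel K i) p\<rparr>"
  define T where "T = coset (boundaries (sublevel K j) p)"
  define S where "S = coset (boundaries (sublevel L j) p)"
  have V: "carrier V = cycles (sublevel K i) p" "add V = (+)" "zero V = 0"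
      "smult V = (\<lambda>k x A. k * x A)"
    by (simp_all add: V_def)
  have f0: "f 0 = 0" using smult[of 0 0] by (simp add: zero_fun_def)
  have diff: "f (x - y) = f x - f y" for x y
    using add[of "x - y" y] by simp
  show ?thesis
    unfolding persistent_betti_def linear_rank_def
  proof (rule dim_eq_if_same_fibres[of V T _ "\<lambda>z. S (f z)"])
    show "vectorspace class_ring V"
      unfolding V_def by (rule vectorspace_linearly_closed) (rule linearly_closed_cycles)
    show "T ` carrier V = carrier ((homology (sublevel K j) p)
        \<lparr>carrier := inclusion_homology (sublevel K j) p ` carrier (homology (sublevel K i) p)\<rparr>)"
      by (simp add: image_inclusion_homology[OF K le] T_def V)
    show "(\<lambda>z. S (f z)) ` carrier V = carrier ((homology (sublevel L j) p)
        \<lparr>carrier := inclusion_homology (sublevel L j) p ` carrier (homology (sublevel L i) p)\<rparr>)"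
      by (simp add: image_inclusion_homology[OF L le] S_def V flip: cycles) (simp add: image_image)
    fix v w assume "v \<in> carrier V" "w \<in> carrier V"
    then have "v - w \<in> cycles (sublevel K i) p"
      using linearly_closedD(4)[OF linearly_closed_cycles] V by blast
    then show "T v = T w \<longleftrightarrow> S (f v) = S (f w)"
      unfolding T_def S_def
      by (simp add: coset_eq_iff[OF linearly_closed_boundaries] boundaries diff)
  qed (simp_all add: V T_def S_def homology_ops coset_plus_coset add smult f0
      coset_smult[OF linearly_closed_boundaries])
qed

section \<open>Cancelling an acyclic matching\<close>

definition supported_on :: "('c \<Rightarrow> 'f::zero) \<Rightarrow> 'c set \<Rightarrow> bool" where
  "supported_on x S \<longleftrightarrow> (\<forall>A. A \<notin> S \<longrightarrow> x A = 0)"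

context filtered_chain_complex
begin

text \<open>The locale assumption concerns chains of a single dimension. On single cells it gives a
  matrix identity, which extends linearly to arbitrary functions, so that the operators below can be
  composed without tracking dimensions.\<close>

lemma boundary_boundary_zero: "boundary K (boundary K x) = 0"
proof -
  have unit: "(\<Sum>A\<in>cells K. inc K s A * inc K A b) = 0" if s: "s \<in> cells K" for s b
  proof -
    define e where "e A = (if A = s then 1 else 0 :: 'f)" for A
    have "e \<in> carrier (chains K (cell_dim K s))"
      using s by (auto simp: chains_def e_def)
    from boundary_boundary[OF this] have zero: "boundary K (boundary K e) b = 0" by metis
    have "boundary K e = inc K s"
      using s finite_cells by (simp add: boundary_def e_def fun_eq_iff if_distrib[of "\<lambda>u. u * _"] cong: if_cong)
    from zero[unfolded this] show ?thesis by (simp add: boundary_def)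
  qed
  have "boundary K (boundary K x) b = 0" for b
  proof -
    have "boundary K (boundary K x) b = (\<Sum>A\<in>cells K. \<Sum>s\<in>cells K. x s * (inc K s A * inc K A b))"
      by (simp add: boundary_def sum_distrib_right mult.assoc)
    also have "\<dots> = (\<Sum>s\<in>cells K. \<Sum>A\<in>cells K. x s * (inc K s A * inc K A b))"
      by (rule sum.swap)
    also have "\<dots> = 0"
      by (simp add: unit flip: sum_distrib_left)
    finally show ?thesis .
  qed
  then show ?thesis by (simp add: fun_eq_iff)
qed

lemma boundary_supported: "supported_on (boundary K x) (cells K)"
  unfolding supported_on_def boundary_def
  using inc_nonzero by (metis (mono_tags, lifting) mult_zero_right sum.neutral)

lemma boundary_in_chains:
  assumes "x \<in> carrier (chains (sublevel K t) (p + 1))"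
  shows "boundary K x \<in> carrier (chains (sublevel K t) p)"
  unfolding carrier_chains_sublevel
proof (intro allI impI)
  fix b assume "boundary K x b \<noteq> 0"
  then obtain A where A: "x A \<noteq> 0" "inc K A b \<noteq> 0"
    unfolding boundary_def by (metis (no_types, lifting) mult_eq_0_iff sum.neutral)
  then show "b \<in> cells K \<and> filt K b \<le> t \<and> cell_dim K b = p"
    using assms inc_nonzero[of A b] filt_face[of b A]
    by (fastforce simp: carrier_chains_sublevel face_def)
qed

lemma boundary_vertices:
  assumes "x \<in> carrier (chains (sublevel K t) 0)"
  shows "boundary K x = 0"
proof -
  have "x A * inc K A b = 0" for A b
    using assms inc_nonzero[of A b] by (auto simp: carrier_chains_sublevel)
  then show ?thesis by (simp add: boundary_def fun_eq_iff)
qed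

end

section \<open>Matched pairs and descent in the Morse graph\<close>

locale filtered_matching = filtered_chain_complex K for K :: "('c, 'f::field) cell_complex" +
  fixes M :: "('c \<times> 'c) set"
  assumes acyclic_matching: "acyclic_matching K M"
    and compatible: "compatible K M"
begin

abbreviation tops :: "'c set" where "tops \<equiv> fst ` M"
abbreviation bots :: "'c set" where "bots \<equiv> snd ` M"
abbreviation crit :: "'c set" where "crit \<equiv> critical K M"

definition mate :: "'c \<Rightarrow> 'c" where "mate b = (THE A. (A, b) \<in> M)"

lemma matching: "matching K M"
  using acyclic_matching by (simp add: acyclic_matching_def)

lemma pair_cells: "(A, b) \<in> M \<Longrightarrow> A \<in> cells K \<and> b \<in> cells K \<and> inc K A b \<noteq> 0"
  using matching by (auto simp: matching_def)

lemma disjoint_pairs: "(A, b) \<in> M \<Longrightarrow> (A', b') \<in> M \<Longrightarrow> (A, b) \<noteq> (A', b') \<Longrightarrow>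
    A \<noteq> A' \<and> b \<noteq> b' \<and> A \<noteq> b' \<and> b \<noteq> A'"
  using matching unfolding matching_def by blast

lemma mate_eq: "(A, b) \<in> M \<Longrightarrow> mate b = A"
  unfolding mate_def using disjoint_pairs by blast

lemma mate_pair: "b \<in> bots \<Longrightarrow> (mate b, b) \<in> M"
  using mate_eq by force

lemma mate_cells: "b \<in> bots \<Longrightarrow> mate b \<in> cells K \<and> b \<in> cells K \<and> inc K (mate b) b \<noteq> 0"
  using mate_pair pair_cells by blast

lemma filt_mate: "b \<in> bots \<Longrightarrow> filt K (mate b) = filt K b"
  using mate_pair compatible by (force simp: compatible_def)

lemma tops_bots_disjoint: "tops \<inter> bots = {}"
proof -
  have False if "(A, b) \<in> M" "(B, A) \<in> M" for A b B
  proof (cases "(A, b) = (B, A)")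
    case True
    \<comment> \<open>Disjointness is required of distinct pairs only; a pair \<open>(A, A)\<close>
      is excluded by dimension.\<close>
    then show False using pair_cells[OF that(1)] inc_nonzero[of A A] by auto
  next
    case False
    then show False using disjoint_pairs[OF that] by blast
  qed
  then show ?thesis by force
qed

lemma in_tops_bots: "(A, b) \<in> M \<Longrightarrow> A \<in> tops \<and> b \<in> bots"
  by force

lemma tops_eq: "tops = mate ` bots"
proof (intro equalityI subsetI)
  fix A assume "A \<in> tops"
  then obtain b where "(A, b) \<in> M" by auto
  then show "A \<in> mate ` bots" using mate_eq in_tops_bots by blast
next
  fix A assume "A \<in> mate ` bots"
  then obtain b where "b \<in> bots" "A = mate b" by blast
  then show "A \<in> tops" using mate_pair in_tops_bots by blast
qed

lemma bots_cells: "bots \<subseteq> cells K" and tops_cells: "tops \<subseteq> cells K"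
  using pair_cells by force+

lemma finite_bots: "finite bots"
  using bots_cells finite_cells by (rule finite_subset)

lemma critical_cells: "crit = cells K - (tops \<union> bots)"
  by (simp add: critical_def)

lemma finite_critical: "finite crit"
  using finite_cells by (simp add: critical_def)

text \<open>Back substitution and the recursion on paths both descend along this order. The
  transitive closure lets the two edges from \<open>s\<close> to \<open>a\<close> and from
  \<open>a\<close> to \<open>mate a\<close> count as one step.\<close>

lemma wf_morse_graph: "wf (((morse_graph K M)\<inverse>)\<^sup>+)"
proof -
  have "morse_graph K M \<subseteq> cells K \<times> cells K"
    using pair_cells by (auto simp: morse_graph_def down_edges_def)
  then have "finite (morse_graph K M)"
    using finite_cells by (meson finite_SigmaI finite_subset)
  then show ?thesis
    using acyclic_matching
    by (intro wf_trancl finite_acyclic_wf_converse) (simp_all add: acyclic_matching_def)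
qed

lemma down_edge_mate:
  assumes "(s, a) \<in> down_edges K M" "a \<in> bots"
  shows "(mate a, s) \<in> ((morse_graph K M)\<inverse>)\<^sup>+"
proof -
  have "(mate a, a) \<in> (morse_graph K M)\<inverse>" "(a, s) \<in> (morse_graph K M)\<inverse>"
    using assms mate_pair by (auto simp: morse_graph_def)
  then show ?thesis by (rule trancl_into_trancl[OF r_into_trancl])
qed

text \<open>Indexing each top by its bottom makes the boundary from \<open>tops\<close> to
  \<open>bots\<close> a square matrix. These are the positions of its nonzero off-diagonal entries;
  the diagonal holds the matched incidences.\<close>

definition zigzag :: "('c \<times> 'c) set" where
  "zigzag = {(a, b). a \<in> bots \<and> b \<in> bots \<and> a \<noteq> b \<and> inc K (mate b) a \<noteq> 0}"

lemma wf_zigzag: "wf zigzag"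
proof -
  have "zigzag \<subseteq> inv_image (((morse_graph K M)\<inverse>)\<^sup>+) mate"
  proof clarify
    fix a b assume "(a, b) \<in> zigzag"
    then have ab: "a \<in> bots" "b \<in> bots" "a \<noteq> b" "inc K (mate b) a \<noteq> 0"
      by (auto simp: zigzag_def)
    have "(mate b, a) \<notin> M"
      using ab mate_pair disjoint_pairs by (metis Pair_inject)
    then have "(mate b, a) \<in> down_edges K M"
      using ab inc_nonzero[of "mate b" a] by (simp add: down_edges_def)
    then show "(a, b) \<in> inv_image (((morse_graph K M)\<inverse>)\<^sup>+) mate"
      using ab down_edge_mate by simp
  qed
  then show ?thesis using wf_morse_graph by (meson wf_inv_image wf_subset)
qed

text \<open>
  The boundary operator from the span of \<open>tops\<close> to the span of \<open>bots\<close> is triangular along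
  \<open>zigzag\<close>; \<open>lift b\<close> is the preimage of \<open>b\<close> found by back substitution.
\<close>

definition lift :: "'c \<Rightarrow> 'c \<Rightarrow> 'f" where
  "lift = wfrec zigzag (\<lambda>g b A. inverse (inc K (mate b) b) *
    ((if A = mate b then 1 else 0) -
      (\<Sum>a \<in> {a. (a, b) \<in> zigzag}. inc K (mate b) a * g a A)))"

text \<open>The \<open>wfrec\<close> definition may call itself only along \<open>zigzag\<close>;
  the additional terms on the right have incidence 0.\<close>

lemma sum_zigzag:
  assumes "b \<in> bots"
  shows "(\<Sum>a\<in>{a. (a, b) \<in> zigzag}. inc K (mate b) a * g a) =
    (\<Sum>a\<in>bots - {b}. inc K (mate b) a * g a)"
  using assms finite_bots by (intro sum.mono_neutral_left) (auto simp: zigzag_def)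

lemma lift_eq:
  assumes "b \<in> bots"
  shows "lift b A = inverse (inc K (mate b) b) *
    ((if A = mate b then 1 else 0) - (\<Sum>a\<in>bots - {b}. inc K (mate b) a * lift a A))"
  unfolding sum_zigzag[OF assms, symmetric]
  by (subst (1) lift_def, subst wfrec[OF wf_zigzag]) (simp add: cut_apply flip: lift_def)

text \<open>This is the recursion for \<open>lift b\<close> multiplied by its diagonal entry. It
  makes \<open>lift\<close> a left inverse of the boundary from \<open>tops\<close> to
  \<open>bots\<close>.\<close>

lemma lift_boundary_mate:
  assumes "b \<in> bots"
  shows "(\<Sum>a\<in>bots. inc K (mate b) a * lift a A) = (if A = mate b then 1 else 0)"
  using mate_cells[OF assms]
  unfolding sum.remove[OF finite_bots assms] lift_eq[OF assms, of A]
  by (simp flip: mult.assoc)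

text \<open>The other side of the inverse. It is not a rearrangement of the recursion and needs
  induction along \<open>zigzag\<close>: the terms with \<open>c \<noteq> b\<close> remove every
  entry of the boundary of \<open>mate b\<close> on \<open>bots\<close> except the one at
  \<open>b\<close>.\<close>

lemma boundary_lift:
  assumes "b \<in> bots" "a \<in> bots"
  shows "boundary K (lift b) a = (if a = b then 1 else 0)"
  using wf_zigzag assms(1)
proof (induction b rule: wf_induct_rule)
  case (less b)
  let ?k = "inc K (mate b) b"
  have IH: "inc K (mate b) c * boundary K (lift c) a = inc K (mate b) c * (if a = c then 1 else 0)"
    if "c \<in> bots - {b}" for c
    using less that by (cases "inc K (mate b) c = 0") (auto simp: zigzag_def)
  have "boundary K (lift b) a = (\<Sum>A\<in>cells K. inverse ?k *
    ((if A = mate b then inc K A a else 0) -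
      (\<Sum>c\<in>bots - {b}. inc K (mate b) c * (lift c A * inc K A a))))"
    unfolding boundary_def
    by (rule sum.cong) (auto simp: lift_eq[OF less.prems] left_diff_distrib sum_distrib_right
        mult.assoc right_diff_distrib)
  also have "\<dots> = inverse ?k * (inc K (mate b) a -
      (\<Sum>A\<in>cells K. \<Sum>c\<in>bots - {b}. inc K (mate b) c * (lift c A * inc K A a)))"
    using mate_cells[OF less.prems] finite_cells by (simp add: sum_subtractf flip: sum_distrib_left)
  also have "(\<Sum>A\<in>cells K. \<Sum>c\<in>bots - {b}. inc K (mate b) c * (lift c A * inc K A a)) =
      (\<Sum>c\<in>bots - {b}. inc K (mate b) c * boundary K (lift c) a)"
    unfolding boundary_def sum_distrib_left by (rule sum.swap)
  also have "\<dots> = (\<Sum>c\<in>bots - {b}. inc K (mate b) c * (if a = c then 1 else 0))"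
    using IH by (rule sum.cong[OF refl])
  also have "\<dots> = (if a = b then 0 else inc K (mate b) a)"
    using assms(2) finite_bots by (simp add: if_distrib[of "\<lambda>u. _ * u"] cong: if_cong)
  finally show ?case using mate_cells[OF less.prems] by auto
qed

text \<open>Compatibility enters here: \<open>mate b\<close> has the value of \<open>b\<close>, and
  any further bottom \<open>a\<close> in its boundary has at most that value, so back substitution
  never leaves the sublevel of \<open>b\<close>.\<close>

lemma lift_nonzero:
  assumes "b \<in> bots" "lift b A \<noteq> 0"
  shows "A \<in> tops \<and> cell_dim K A = cell_dim K b + 1 \<and> filt K A \<le> filt K b"
  using wf_zigzag assms
proof (induction b rule: wf_induct_rule)
  case (less b)
  have b: "cell_dim K (mate b) = cell_dim K b + 1" "filt K (mate b) = filt K b"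
    using mate_cells[OF less.prems(1)] inc_nonzero filt_mate[OF less.prems(1)] by auto
  show ?case
  proof (cases "A = mate b")
    case True
    then show ?thesis using b tops_eq imageI[OF less.prems(1), of mate] by simp
  next
    case False
    then have "(\<Sum>a\<in>bots - {b}. inc K (mate b) a * lift a A) \<noteq> 0"
      using less.prems lift_eq[OF less.prems(1), of A] by auto
    then obtain a where a: "a \<in> bots - {b}" "inc K (mate b) a * lift a A \<noteq> 0"
      by (rule sum.not_neutral_contains_not_neutral)
    then have "(a, b) \<in> zigzag" using less.prems by (auto simp: zigzag_def)
    then have "A \<in> tops \<and> cell_dim K A = cell_dim K a + 1 \<and> filt K A \<le> filt K a"
      using less.IH a by auto
    moreover have "cell_dim K (mate b) = cell_dim K a + 1" "filt K a \<le> filt K (mate b)"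
      using a inc_nonzero[of "mate b" a] filt_face[of a "mate b"] by (auto simp: face_def)
    ultimately show ?thesis using b by auto
  qed
qed

section \<open>The homotopy and the projection it defines\<close>

definition homotopy :: "('c \<Rightarrow> 'f) \<Rightarrow> 'c \<Rightarrow> 'f" where
  "homotopy x = (\<lambda>A. \<Sum>b\<in>bots. x b * lift b A)"

lemma homotopy_add: "homotopy (x + y) = homotopy x + homotopy y"
  by (simp add: homotopy_def fun_eq_iff distrib_right sum.distrib)

lemma homotopy_smult: "homotopy (\<lambda>A. k * x A) = (\<lambda>A. k * homotopy x A)"
  by (simp add: homotopy_def fun_eq_iff sum_distrib_left mult_ac)

lemma homotopy_diff: "homotopy (x - y) = homotopy x - homotopy y"
  by (simp add: homotopy_def fun_eq_iff left_diff_distrib sum_subtractf)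

lemma homotopy_supported: "supported_on (homotopy x) tops"
  unfolding supported_on_def homotopy_def
  by (metis (no_types, lifting) lift_nonzero mult_zero_right sum.neutral)

lemma homotopy_zero: "(\<And>b. b \<in> bots \<Longrightarrow> x b = 0) \<Longrightarrow> homotopy x = 0"
  by (simp add: homotopy_def fun_eq_iff)

lemma homotopy_supported_zero:
  assumes "supported_on x S" "S \<inter> bots = {}"
  shows "homotopy x = 0"
  using assms by (intro homotopy_zero) (auto simp: supported_on_def)

lemma homotopy_in_chains:
  assumes "x \<in> carrier (chains (sublevel K t) p)"
  shows "homotopy x \<in> carrier (chains (sublevel K t) (p + 1))"
  unfolding carrier_chains_sublevel
proof (intro allI impI)
  fix A assume "homotopy x A \<noteq> 0"
  then obtain b where b: "b \<in> bots" "x b \<noteq> 0" "lift b A \<noteq> 0"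
    unfolding homotopy_def by (metis (no_types, lifting) mult_eq_0_iff sum.neutral)
  then show "A \<in> cells K \<and> filt K A \<le> t \<and> cell_dim K A = p + 1"
    using assms lift_nonzero[of b A] tops_cells by (fastforce simp: carrier_chains_sublevel)
qed

lemma boundary_homotopy_bots:
  assumes "a \<in> bots"
  shows "boundary K (homotopy x) a = x a"
proof -
  have "boundary K (homotopy x) a = (\<Sum>b\<in>bots. x b * boundary K (lift b) a)"
    unfolding boundary_def homotopy_def sum_distrib_left sum_distrib_right mult.assoc
    by (rule sum.swap)
  also have "\<dots> = (\<Sum>b\<in>bots. if a = b then x b else 0)"
    using assms by (intro sum.cong) (auto simp: boundary_lift)
  finally show ?thesis using assms finite_bots by simp
qed

lemma homotopy_boundary_tops:
  assumes "supported_on y tops"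
  shows "homotopy (boundary K y) = y"
proof
  fix A
  have "homotopy (boundary K y) A = (\<Sum>B\<in>cells K. y B * (\<Sum>b\<in>bots. inc K B b * lift b A))"
    unfolding boundary_def homotopy_def sum_distrib_left sum_distrib_right mult.assoc
    by (rule sum.swap)
  also have "\<dots> = (\<Sum>B\<in>cells K. if A = B then y B else 0)"
  proof (rule sum.cong[OF refl])
    fix B
    show "y B * (\<Sum>b\<in>bots. inc K B b * lift b A) = (if A = B then y B else 0)"
    proof (cases "B \<in> tops")
      case True
      then obtain b where "b \<in> bots" "B = mate b" using tops_eq by blast
      then show ?thesis using lift_boundary_mate[of b A] by simp
    next
      case False
      then show ?thesis using assms by (simp add: supported_on_def)
    qed
  qed
  also have "\<dots> = y A"
    using finite_cells assms tops_cells by (auto simp: supported_on_def)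
  finally show "homotopy (boundary K y) A = y A" .
qed

definition projection :: "('c \<Rightarrow> 'f) \<Rightarrow> 'c \<Rightarrow> 'f" where
  "projection x = x - boundary K (homotopy x) - homotopy (boundary K x)"

definition critical_part :: "('c \<Rightarrow> 'f) \<Rightarrow> 'c \<Rightarrow> 'f" where
  "critical_part x = (\<lambda>A. if A \<in> crit then x A else 0)"

lemma homotopy_of_zero: "homotopy 0 = 0"
  by (rule homotopy_zero) simp

lemma projection_add: "projection (x + y) = projection x + projection y"
  by (simp add: projection_def boundary_add homotopy_add)

lemma projection_diff: "projection (x - y) = projection x - projection y"
  by (simp add: projection_def boundary_diff homotopy_diff)

lemma projection_zero: "projection 0 = 0"
  by (simp add: projection_def boundary_zero homotopy_of_zero)

lemma projection_smult: "projection (\<lambda>A. k * x A) = (\<lambda>A. k * projection x A)"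
  by (simp add: projection_def boundary_smult homotopy_smult fun_eq_iff right_diff_distrib)

lemma boundary_projection: "boundary K (projection x) = projection (boundary K x)"
  by (simp add: projection_def boundary_diff boundary_boundary_zero homotopy_of_zero)

lemma projection_bots: "b \<in> bots \<Longrightarrow> projection x b = 0"
  using homotopy_supported[of "boundary K x"] tops_bots_disjoint
  by (auto simp: projection_def boundary_homotopy_bots supported_on_def)

lemma projection_tops:
  assumes "supported_on y tops"
  shows "projection y = 0"
  using homotopy_supported_zero[OF assms tops_bots_disjoint] homotopy_boundary_tops[OF assms]
  by (simp add: projection_def boundary_zero)

text \<open>A chain is fixed by \<open>projection\<close> if \<open>homotopy\<close> kills both it
  and its boundary. For \<open>projection x\<close> the former holds because it vanishes on
  \<open>bots\<close>, the latter because \<open>homotopy (boundary K x)\<close> is supported on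
  \<open>tops\<close>, where \<open>homotopy\<close> inverts the boundary.\<close>

lemma projection_idem: "projection (projection x) = projection x"
proof -
  have "homotopy (boundary K (homotopy (boundary K x))) = homotopy (boundary K x)"
    by (rule homotopy_boundary_tops[OF homotopy_supported])
  then have "homotopy (boundary K (projection x)) = 0"
    by (simp add: boundary_projection)
      (simp add: projection_def homotopy_diff boundary_boundary_zero homotopy_of_zero)
  moreover have "homotopy (projection x) = 0"
    by (rule homotopy_zero) (rule projection_bots)
  ultimately show ?thesis by (subst projection_def) (simp add: boundary_zero)
qed

lemma projection_in_chains:
  assumes "x \<in> carrier (chains (sublevel K t) p)"
  shows "projection x \<in> carrier (chains (sublevel K t) p)"
proof -
  note closed = linearly_closedD[OF linearly_closed_chains[of "sublevel K t" p]]
  have "homotopy (boundary K x) \<in> carrier (chains (sublevel K t) p)"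
  \<comment> \<open>Dimensions are natural numbers, so lowering and then raising the dimension fails
    at 0, where the boundary is zero anyway.\<close>
  proof (cases p)
    case 0
    then show ?thesis
      using assms closed(1) by (simp add: boundary_vertices homotopy_of_zero)
  next
    case (Suc q)
    then show ?thesis
      using assms boundary_in_chains[of x t q] homotopy_in_chains[of _ t q] by simp
  qed
  then show ?thesis
    unfolding projection_def
    by (intro closed(4) assms boundary_in_chains homotopy_in_chains)
qed

lemma projection_supported:
  assumes "supported_on x (cells K)"
  shows "supported_on (projection x) (cells K)"
proof -
  have "supported_on (homotopy (boundary K x)) (cells K)"
    using homotopy_supported tops_cells unfolding supported_on_def by blast
  then show ?thesis
    using assms boundary_supported[of "homotopy x"] by (simp add: supported_on_def projection_def)
qed

lemma critical_part_supported: "supported_on (critical_part x) crit"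
  by (simp add: critical_part_def supported_on_def)

lemma critical_part_zero: "critical_part 0 = 0"
  by (simp add: critical_part_def fun_eq_iff)

text \<open>A projected chain vanishes on \<open>bots\<close>, so it differs from its critical part
  only on \<open>tops\<close>, and such chains are killed by \<open>projection\<close>.\<close>

lemma projection_critical_part:
  assumes "supported_on x (cells K)"
  shows "projection (critical_part (projection x)) = projection x"
proof -
  have "supported_on (projection x - critical_part (projection x)) tops"
    using projection_supported[OF assms] projection_bots[of _ x]
    by (auto simp: supported_on_def critical_part_def critical_cells)
  then have "projection (projection x - critical_part (projection x)) = 0"
    by (rule projection_tops)
  then show ?thesis by (simp add: projection_diff projection_idem)
qed

lemma homotopy_critical: "supported_on x crit \<Longrightarrow> homotopy x = 0"
  by (rule homotopy_supported_zero) (auto simp: critical_cells)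

lemma projection_critical:
  "supported_on x crit \<Longrightarrow> projection x = x - homotopy (boundary K x)"
  by (simp add: projection_def homotopy_critical boundary_zero)

text \<open>On a critical chain the correction made by \<open>projection\<close> lives on
  \<open>tops\<close> and is invisible on critical cells.\<close>

lemma critical_part_projection_critical:
  assumes "supported_on x crit"
  shows "critical_part (projection x) = x"
  using assms homotopy_supported[of "boundary K x"]
  by (auto simp: projection_critical critical_part_def supported_on_def fun_eq_iff critical_cells)

section \<open>The Morse complex\<close>

definition path_sum :: "'c \<Rightarrow> 'c \<Rightarrow> 'f" where
  "path_sum s c = (\<Sum>ps | morse_path K M s ps c. path_weight K s ps c)"

lemma morse_path_Nil: "morse_path K M s [] c \<longleftrightarrow> (s, c) \<in> down_edges K M"
  by (simp add: morse_path_def path_top_def path_bot_def)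

lemma path_top_Cons: "path_top s (q # ps) (Suc i) = path_top (fst q) ps i"
  by (simp add: path_top_def)

text \<open>Bottoms are numbered from 1, so the shift is valid from index 2 on; index 1 is the
  bottom of the new pair.\<close>

lemma path_bot_Cons: "path_bot (q # ps) c (Suc (Suc i)) = path_bot ps c (Suc i)"
  by (simp add: path_bot_def)

lemma morse_path_Cons:
  "morse_path K M s (q # ps) c \<longleftrightarrow>
    q \<in> M \<and> (s, snd q) \<in> down_edges K M \<and> morse_path K M (fst q) ps c"
proof -
  have "(\<forall>i \<in> {0..length (q # ps)}. P i) \<longleftrightarrow> P 0 \<and> (\<forall>i \<in> {0..length ps}. P (Suc i))" for P
    by (simp only: length_Cons atLeast0AtMost atMost_Suc_eq_insert_0 ball_simps)
  moreover have "path_top s (q # ps) 0 = s" "path_bot (q # ps) c (Suc 0) = snd q"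
    by (simp_all add: path_top_def path_bot_def)
  ultimately show ?thesis
    by (auto simp: morse_path_def path_top_Cons path_bot_Cons simp del: length_Cons)
qed

lemma path_weight_Nil: "path_weight K s [] c = inc K s c"
  by (simp add: path_weight_def path_top_def path_bot_def)

text \<open>The numerator of the factor with index 1 becomes the leading incidence of the shorter
  path; its inverse and the old leading incidence split off, together with one sign.\<close>

lemma path_weight_Cons:
  "path_weight K s (q # ps) c =
    - (inc K s (snd q) * inverse (inc K (fst q) (snd q)) * path_weight K (fst q) ps c)"
proof -
  define g where "g i = inverse (inc K (path_top s (q # ps) i) (path_bot (q # ps) c i)) *
      inc K (path_top s (q # ps) i) (path_bot (q # ps) c (i + 1))" for i
  have "(\<Prod>i = 1..length (q # ps). g i) = g 1 * (\<Prod>i = 1..length ps. g (Suc i))"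
    using prod.atLeast_Suc_atMost[of 1 "length (q # ps)" g]
      prod.shift_bounds_cl_Suc_ivl[of g 1 "length ps"] by simp
  moreover have "g (Suc i) = inverse (inc K (path_top (fst q) ps i) (path_bot ps c i)) *
      inc K (path_top (fst q) ps i) (path_bot ps c (i + 1))" if "i \<ge> 1" for i
    using that path_bot_Cons[of q ps c "i - 1"] by (simp add: g_def path_top_Cons path_bot_Cons)
  moreover have "g 1 = inverse (inc K (fst q) (snd q)) *
      inc K (path_top (fst q) ps 0) (path_bot ps c 1)"
    by (simp add: g_def path_top_def path_bot_def)
  ultimately show ?thesis
    unfolding path_weight_def g_def[symmetric]
    by (simp add: path_top_def path_bot_def mult_ac)
qed

lemma paths_eq:
  "{ps. morse_path K M s ps c} = (if (s, c) \<in> down_edges K M then {[]} else {}) \<union>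
    (\<Union>a \<in> {a \<in> bots. (s, a) \<in> down_edges K M}.
      Cons (mate a, a) ` {ps. morse_path K M (mate a) ps c})"
  (is "?L = ?N \<union> ?C")
proof (intro equalityI subsetI)
  fix ps assume ps: "ps \<in> ?L"
  show "ps \<in> ?N \<union> ?C"
  proof (cases ps)
    case Nil
    then show ?thesis using ps by (simp add: morse_path_Nil)
  next
    case (Cons q qs)
    then have q: "q \<in> M" "(s, snd q) \<in> down_edges K M" "morse_path K M (fst q) qs c"
      using ps by (simp_all add: morse_path_Cons)
    moreover have "mate (snd q) = fst q" "snd q \<in> bots"
      using q(1) mate_eq[of "fst q" "snd q"] by simp_all
    ultimately have "qs \<in> {ps. morse_path K M (mate (snd q)) ps c}" "q = (mate (snd q), snd q)"
        "snd q \<in> {a \<in> bots. (s, a) \<in> down_edges K M}"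
      by simp_all
    then show ?thesis using Cons by blast
  qed
next
  fix ps assume "ps \<in> ?N \<union> ?C"
  then consider "ps \<in> ?N" | "ps \<in> ?C" by blast
  then show "ps \<in> ?L"
  proof cases
    case 1
    then show ?thesis by (simp add: morse_path_Nil split: if_splits)
  next
    case 2
    then obtain a qs where "a \<in> bots" "(s, a) \<in> down_edges K M"
        "morse_path K M (mate a) qs c" "ps = (mate a, a) # qs"
      by blast
    then show ?thesis using mate_pair by (simp add: morse_path_Cons)
  qed
qed

text \<open>Over an infinite set \<open>sum\<close> would be 0 by convention, and splitting by the
  first step would fail.\<close>

lemma finite_paths: "finite {ps. morse_path K M s ps c}"
  using wf_morse_graph
proof (induction s rule: wf_induct_rule)
  case (less s)
  show ?case
    unfolding paths_eq[of s] using finite_bots down_edge_mate less by auto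
qed

text \<open>After one step the source is a top, which is why \<open>path_sum\<close> admits
  noncritical sources.\<close>

lemma path_sum_rec:
  "path_sum s c = (if (s, c) \<in> down_edges K M then inc K s c else 0) -
    (\<Sum>a | a \<in> bots \<and> (s, a) \<in> down_edges K M.
      inc K s a * (inverse (inc K (mate a) a) * path_sum (mate a) c))"
proof -
  let ?N = "if (s, c) \<in> down_edges K M then {[]} else {}"
  let ?I = "{a \<in> bots. (s, a) \<in> down_edges K M}"
  let ?C = "\<lambda>a. Cons (mate a, a) ` {ps. morse_path K M (mate a) ps c}"
  have "path_sum s c = (\<Sum>ps\<in>?N. path_weight K s ps c) + (\<Sum>ps\<in>(\<Union>a\<in>?I. ?C a). path_weight K s ps c)"
    unfolding path_sum_def paths_eq[of s]
    by (rule sum.union_disjoint) (use finite_bots finite_paths in auto)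
  also have "(\<Sum>ps\<in>(\<Union>a\<in>?I. ?C a). path_weight K s ps c) = (\<Sum>a\<in>?I. \<Sum>ps\<in>?C a. path_weight K s ps c)"
    by (rule sum.UNION_disjoint) (use finite_bots finite_paths in auto)
  also have "\<dots> = (\<Sum>a\<in>?I. - (inc K s a * (inverse (inc K (mate a) a) * path_sum (mate a) c)))"
    by (simp add: sum.reindex path_weight_Cons path_sum_def sum_distrib_left sum_negf mult.assoc)
  finally show ?thesis by (simp add: sum_negf path_weight_Nil)
qed

text \<open>
  On chains over \<open>tops\<close> the boundary coefficient at a critical cell \<open>c\<close> is determined by those at
  \<open>bots\<close>; the functional doing this (\<open>boundary_tops\<close> below) has coefficients \<open>exit_weight c\<close>.
\<close>

definition exit_weight :: "'c \<Rightarrow> 'c \<Rightarrow> 'f" where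
  "exit_weight c a = inverse (inc K (mate a) a) * path_sum (mate a) c"

lemma down_edge_iff: "(s, a) \<in> down_edges K M \<longleftrightarrow> inc K s a \<noteq> 0 \<and> (s, a) \<notin> M"
  using inc_nonzero[of s a] by (auto simp: down_edges_def)

lemma path_sum_exit:
  assumes "c \<in> crit"
  shows "path_sum s c = inc K s c - (\<Sum>a | a \<in> bots \<and> (s, a) \<notin> M. inc K s a * exit_weight c a)"
proof -
  have "(s, c) \<notin> M" using assms in_tops_bots by (auto simp: critical_cells)
  then have "(if (s, c) \<in> down_edges K M then inc K s c else 0) = inc K s c"
    by (simp add: down_edge_iff)
  moreover have "(\<Sum>a | a \<in> bots \<and> (s, a) \<in> down_edges K M. inc K s a * exit_weight c a) =
      (\<Sum>a | a \<in> bots \<and> (s, a) \<notin> M. inc K s a * exit_weight c a)"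
    using finite_bots by (intro sum.mono_neutral_left) (auto simp: down_edge_iff)
  ultimately show ?thesis
    using path_sum_rec[of s c] by (simp add: exit_weight_def)
qed

lemma path_sum_critical:
  assumes "s \<in> crit" "c \<in> crit"
  shows "path_sum s c = inc K s c - (\<Sum>a\<in>bots. inc K s a * exit_weight c a)"
proof -
  have "{a. a \<in> bots \<and> (s, a) \<notin> M} = bots"
    using assms(1) in_tops_bots by (auto simp: critical_cells)
  then show ?thesis by (simp only: path_sum_exit[OF assms(2)])
qed

text \<open>For \<open>A = mate b\<close> the recursion omits only the term of \<open>b\<close>, and
  by the choice of \<open>exit_weight\<close> that term equals the path sum from \<open>A\<close>.
  Moving it across completes the sum over \<open>bots\<close>.\<close>

lemma inc_top:
  assumes "A \<in> tops" "c \<in> crit"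
  shows "inc K A c = (\<Sum>a\<in>bots. inc K A a * exit_weight c a)"
proof -
  obtain b where b: "b \<in> bots" "A = mate b" using assms(1) tops_eq by blast
  have "{a. a \<in> bots \<and> (A, a) \<notin> M} = bots - {b}"
    using b mate_pair disjoint_pairs by (blast dest: mate_eq)
  moreover have "path_sum A c = inc K A b * exit_weight c b"
    using b mate_cells[OF b(1)] by (simp add: exit_weight_def)
  ultimately show ?thesis
    using path_sum_exit[OF assms(2), of A] by (simp add: sum.remove[OF finite_bots b(1)] diff_eq_eq)
qed

lemma boundary_tops:
  assumes "supported_on y tops" "c \<in> crit"
  shows "boundary K y c = (\<Sum>a\<in>bots. boundary K y a * exit_weight c a)"
proof -
  have "boundary K y c = (\<Sum>A\<in>cells K. y A * (\<Sum>a\<in>bots. inc K A a * exit_weight c a))"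
    unfolding boundary_def
  proof (rule sum.cong[OF refl])
    fix A
    show "y A * inc K A c = y A * (\<Sum>a\<in>bots. inc K A a * exit_weight c a)"
      using assms inc_top[of A c] by (cases "A \<in> tops") (auto simp: supported_on_def)
  qed
  also have "\<dots> = (\<Sum>a\<in>bots. boundary K y a * exit_weight c a)"
    unfolding boundary_def sum_distrib_left sum_distrib_right mult.assoc by (rule sum.swap)
  finally show ?thesis .
qed

text \<open>On \<open>bots\<close>, \<open>inc K s\<close> agrees with the boundary of
  \<open>homotopy (inc K s)\<close>, a chain over \<open>tops\<close>, so
  \<open>boundary_tops\<close> evaluates the weighted sum as the value of that boundary at
  \<open>c\<close>.\<close>

lemma path_sum_eq:
  assumes "s \<in> crit" "c \<in> crit"
  shows "path_sum s c = (inc K s - boundary K (homotopy (inc K s))) c"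
  using boundary_tops[OF homotopy_supported assms(2), of "inc K s"]
  by (simp add: path_sum_critical[OF assms] boundary_homotopy_bots)

lemma reduced_inc_nonzero:
  assumes "(inc K s - boundary K (homotopy (inc K s))) c \<noteq> 0"
  shows "cell_dim K s = cell_dim K c + 1" "filt K c \<le> filt K s"
proof -
  \<comment> \<open>Any face of \<open>s\<close> names the dimension below \<open>s\<close> without
    subtraction on \<open>nat\<close>; if there is none, the whole expression is zero.\<close>
  obtain b where b: "inc K s b \<noteq> 0"
  proof (rule ccontr)
    assume "\<not> thesis"
    then have "inc K s = 0" using that by (auto simp: fun_eq_iff)
    then show False using assms by (simp add: homotopy_of_zero boundary_zero)
  qed
  have chain: "inc K s \<in> carrier (chains (sublevel K (filt K s)) (cell_dim K b))"
    unfolding carrier_chains_sublevel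
  proof (intro allI impI)
    fix A assume A: "inc K s A \<noteq> 0"
    then show "A \<in> cells K \<and> filt K A \<le> filt K s \<and> cell_dim K A = cell_dim K b"
      using inc_nonzero[OF A] inc_nonzero[OF b] filt_face[of A s] by (simp add: face_def)
  qed
  have "inc K s - boundary K (homotopy (inc K s)) \<in>
      carrier (chains (sublevel K (filt K s)) (cell_dim K b))"
    by (intro linearly_closedD(4)[OF linearly_closed_chains] chain
        boundary_in_chains homotopy_in_chains)
  then have "cell_dim K c = cell_dim K b \<and> filt K c \<le> filt K s"
    using assms by (simp add: carrier_chains_sublevel)
  then show "cell_dim K s = cell_dim K c + 1" "filt K c \<le> filt K s"
    using inc_nonzero[OF b] by simp_all
qed

text \<open>The dimension test in the definition is absorbed: the right-hand side vanishes by itself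
  when the dimensions do not fit.\<close>

lemma inc_morse_complex:
  "inc (morse_complex K M) s c = (if s \<in> crit \<and> c \<in> crit
    then (inc K s - boundary K (homotopy (inc K s))) c else 0)"
  using reduced_inc_nonzero(1)[of s c] path_sum_eq[of s c]
  by (auto simp: morse_complex_def path_sum_def[symmetric] simp del: minus_apply fun_diff_def)

lemma morse_complex_simps [simp]:
  "cells (morse_complex K M) = crit" "cell_dim (morse_complex K M) = cell_dim K"
  "filt (morse_complex K M) = filt K"
  by (simp_all add: morse_complex_def)

section \<open>Chain maps between a complex and its Morse complex\<close>

lemma homotopy_sum:
  "homotopy (\<lambda>A. \<Sum>s\<in>S. x s * u s A) = (\<lambda>A. \<Sum>s\<in>S. x s * homotopy (u s) A)"
  unfolding homotopy_def sum_distrib_left sum_distrib_right mult.assoc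
  by (rule ext) (rule sum.swap)

lemma boundary_sum:
  "boundary K (\<lambda>A. \<Sum>s\<in>S. x s * u s A) = (\<lambda>A. \<Sum>s\<in>S. x s * boundary K (u s) A)"
  unfolding boundary_def sum_distrib_left sum_distrib_right mult.assoc
  by (rule ext) (rule sum.swap)

lemma boundary_morse_complex:
  assumes "supported_on x crit"
  shows "boundary (morse_complex K M) x = critical_part (boundary K (projection x))"
proof
  fix c
  have x: "boundary K x = (\<lambda>A. \<Sum>s\<in>crit. x s * inc K s A)"
    unfolding boundary_def
    by (rule ext, rule sum.mono_neutral_right)
      (use assms finite_cells in \<open>auto simp: supported_on_def critical_cells\<close>)
  have "boundary K (projection x) = boundary K x - boundary K (homotopy (boundary K x))"
    by (simp add: projection_critical[OF assms] boundary_diff)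
  then have "boundary K (projection x) c =
      (\<Sum>s\<in>crit. x s * (inc K s c - boundary K (homotopy (inc K s)) c))"
    by (simp add: x homotopy_sum boundary_sum sum_subtractf right_diff_distrib)
  then show "boundary (morse_complex K M) x c = critical_part (boundary K (projection x)) c"
    by (simp add: boundary_def[of "morse_complex K M"] inc_morse_complex critical_part_def)
qed

lemma chain_map:
  assumes "supported_on x (cells K)"
  shows "boundary (morse_complex K M) (critical_part (projection x)) =
    critical_part (projection (boundary K x))"
  by (simp add: boundary_morse_complex[OF critical_part_supported]
      projection_critical_part[OF assms] boundary_projection)

lemma projection_boundary_morse_complex:
  assumes "supported_on x crit"
  shows "projection (boundary (morse_complex K M) x) = boundary K (projection x)"
  by (simp add: boundary_morse_complex[OF assms] boundary_projection
      projection_critical_part[OF boundary_supported])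

text \<open>\<open>projection\<close> intertwines the two boundaries, so the square of the Morse
  boundary is the critical part of a squared boundary in \<open>K\<close>.\<close>

lemma filtered_chain_complex_morse_complex: "filtered_chain_complex (morse_complex K M)"
proof
  show "finite (cells (morse_complex K M))" using finite_critical by simp
next
  fix A b assume "inc (morse_complex K M) A b \<noteq> 0"
  then show "A \<in> cells (morse_complex K M) \<and> b \<in> cells (morse_complex K M) \<and>
      cell_dim (morse_complex K M) A = cell_dim (morse_complex K M) b + 1"
    unfolding inc_morse_complex using reduced_inc_nonzero by (auto split: if_splits)
next
  fix b A assume "face (morse_complex K M) b A"
  then show "filt (morse_complex K M) b \<le> filt (morse_complex K M) A"
    unfolding face_def inc_morse_complex using reduced_inc_nonzero(2)[of A b]
    by (auto split: if_splits)
next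
  fix x p assume "x \<in> carrier (chains (morse_complex K M) p)"
  then have x: "supported_on x crit" by (auto simp: chains_def supported_on_def)
  have "boundary (morse_complex K M) (boundary (morse_complex K M) x) =
      critical_part (boundary K (projection (boundary (morse_complex K M) x)))"
    using boundary_morse_complex[OF x] boundary_morse_complex critical_part_supported by metis
  also have "\<dots> = 0"
    by (simp add: projection_boundary_morse_complex[OF x] boundary_boundary_zero critical_part_zero)
  finally show "boundary (morse_complex K M) (boundary (morse_complex K M) x) = (\<lambda>b. 0)"
    by (simp add: zero_fun_def)
qed

lemma carrier_chains_morse_complex:
  "x \<in> carrier (chains (sublevel (morse_complex K M) t) p) \<longleftrightarrow>
    supported_on x crit \<and> x \<in> carrier (chains (sublevel K t) p)"
  unfolding carrier_chains_sublevel by (auto simp: supported_on_def critical_cells)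

lemma critical_part_in_chains:
  "x \<in> carrier (chains (sublevel K t) p) \<Longrightarrow>
    critical_part x \<in> carrier (chains (sublevel (morse_complex K M) t) p)"
  by (auto simp: carrier_chains_sublevel critical_part_def)

lemma chains_supported: "x \<in> carrier (chains (sublevel K t) p) \<Longrightarrow> supported_on x (cells K)"
  by (auto simp: carrier_chains_sublevel supported_on_def)

lemma persistent_betti_morse_complex:
  assumes "i \<le> j"
  shows "persistent_betti K p i j = persistent_betti (morse_complex K M) p i j"
proof (rule persistent_betti_eq[OF filtered_chain_complex_axioms
      filtered_chain_complex_morse_complex assms, where f = "\<lambda>x. critical_part (projection x)"])
  interpret L: filtered_chain_complex "morse_complex K M"
    by (rule filtered_chain_complex_morse_complex)
  show "critical_part (projection (x + y)) = critical_part (projection x) + critical_part (projection y)"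
    for x y by (simp add: critical_part_def projection_add fun_eq_iff)
  show "critical_part (projection (\<lambda>A. k * x A)) = (\<lambda>A. k * critical_part (projection x) A)"
    for k x by (simp add: critical_part_def projection_smult fun_eq_iff)
  show "(\<lambda>x. critical_part (projection x)) ` cycles (sublevel K i) p =
      cycles (sublevel (morse_complex K M) i) p"
  proof (intro equalityI subsetI)
    fix z assume "z \<in> (\<lambda>x. critical_part (projection x)) ` cycles (sublevel K i) p"
    then show "z \<in> cycles (sublevel (morse_complex K M) i) p"
      using chain_map chains_supported
      by (auto simp: cycles_sublevel L.cycles_sublevel projection_zero critical_part_zero
          intro!: critical_part_in_chains projection_in_chains)
  next
    fix z assume "z \<in> cycles (sublevel (morse_complex K M) i) p"
    then have z: "supported_on z crit" "z \<in> carrier (chains (sublevel K i) p)"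
        "boundary (morse_complex K M) z = 0"
      by (auto simp: L.cycles_sublevel carrier_chains_morse_complex)
    \<comment> \<open>The preimage of a Morse cycle is its projection, whose critical part gives the
      cycle back.\<close>
    have "projection z \<in> cycles (sublevel K i) p"
      using projection_in_chains[OF z(2)] projection_boundary_morse_complex[OF z(1)] z(3)
      by (simp add: cycles_sublevel projection_zero)
    moreover have "z = critical_part (projection (projection z))"
      using critical_part_projection_critical[OF z(1)] by (simp add: projection_idem)
    ultimately show "z \<in> (\<lambda>x. critical_part (projection x)) ` cycles (sublevel K i) p"
      by blast
  qed
  fix z assume "z \<in> cycles (sublevel K i) p"
  then have z: "z \<in> carrier (chains (sublevel K i) p)" "boundary K z = 0"
    by (simp_all add: cycles_sublevel)
  show "z \<in> boundaries (sublevel K j) p \<longleftrightarrow>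
      critical_part (projection z) \<in> boundaries (sublevel (morse_complex K M) j) p"
  proof
    assume "z \<in> boundaries (sublevel K j) p"
    then obtain y where y: "y \<in> carrier (chains (sublevel K j) (p + 1))" "z = boundary K y"
      by (auto simp: boundaries_sublevel)
    then have eq: "critical_part (projection z) =
        boundary (morse_complex K M) (critical_part (projection y))"
      using chain_map chains_supported by metis
    show "critical_part (projection z) \<in> boundaries (sublevel (morse_complex K M) j) p"
      unfolding L.boundaries_sublevel eq
      by (intro imageI critical_part_in_chains projection_in_chains y)
  next
    assume "critical_part (projection z) \<in> boundaries (sublevel (morse_complex K M) j) p"
    then obtain y where y: "supported_on y crit" "y \<in> carrier (chains (sublevel K j) (p + 1))"
        "critical_part (projection z) = boundary (morse_complex K M) y"
      by (auto simp: L.boundaries_sublevel carrier_chains_morse_complex)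
    have "projection z = boundary K (projection y)"
      using projection_critical_part[OF chains_supported[OF z(1)]]
      by (simp add: y(3) projection_boundary_morse_complex[OF y(1)])
    \<comment> \<open>As \<open>z\<close> is a cycle, only the boundary of \<open>homotopy z\<close>
      separates it from its projection; that chain completes the bounding one and stays in the
      sublevel of \<open>j\<close>.\<close>
    then have "z = boundary K (projection y + homotopy z)"
      using z(2) unfolding projection_def[of z] by (simp add: homotopy_of_zero boundary_add algebra_simps)
    moreover have "z \<in> carrier (chains (sublevel K j) p)"
      using z(1) assms by (fastforce simp: carrier_chains_sublevel)
    then have "projection y + homotopy z \<in> carrier (chains (sublevel K j) (p + 1))"
      by (intro linearly_closedD(2)[OF linearly_closed_chains] projection_in_chains
          homotopy_in_chains y)
    ultimately show "z \<in> boundaries (sublevel K j) p"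
      unfolding boundaries_sublevel by blast
  qed
qed

end

lemma sublevel_top:
  assumes "\<And>A. A \<in> cells K \<Longrightarrow> filt K A \<le> t" "\<And>A. A \<in> cells K \<Longrightarrow> filt K A \<le> t'"
  shows "sublevel K t = sublevel K t'"
proof -
  have "{A \<in> cells K. filt K A \<le> t} = {A \<in> cells K. filt K A \<le> t'}"
    using assms by blast
  then show ?thesis by (simp only: sublevel_def)
qed

text \<open>The largest filtration values can differ, as cells have disappeared, and
  \<open>Max\<close> is unspecified if none is left. Sublevels are constant above all cells, which
  reconciles the unbounded intervals.\<close>

lemma persistence_intervals_eq:
  assumes "finite (cells K)" "cells L \<subseteq> cells K" "filt L = filt K"
    and betti: "\<And>i j. i \<le> j \<Longrightarrow> persistent_betti K p i j = persistent_betti L p i j"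
  shows "persistence_intervals K p = persistence_intervals L p"
proof -
  define N where "N = Max (filt K ` cells K)"
  define N' where "N' = Max (filt L ` cells L)"
  have N: "filt K A \<le> N" if "A \<in> cells K" for A
    using that assms(1) by (simp add: N_def)
  have N': "filt L A \<le> N'" if "A \<in> cells L" for A
    using that finite_subset[OF assms(2,1)] by (simp add: N'_def)
  have top: "persistent_betti K p i N = persistent_betti L p i N'" for i
  proof -
    \<comment> \<open>\<open>betti\<close> covers only \<open>i \<le> j\<close>, whereas unbounded
      intervals ask for every \<open>i\<close>; above \<open>N\<close> the sublevel of
      \<open>i\<close> equals that of \<open>N\<close>.\<close>
    define m where "m = min i N"
    have "sublevel K i = sublevel K m" "sublevel L i = sublevel L m"
      using sublevel_top[of K i m] sublevel_top[of L i m] N assms(2,3)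
      by (force simp: m_def min_def)+
    moreover have "sublevel L N = sublevel L N'"
      using N N' assms(2,3) by (intro sublevel_top) auto
    moreover have "persistent_betti K p m N = persistent_betti L p m N"
      by (rule betti) (simp add: m_def)
    ultimately show ?thesis by (simp add: persistent_betti_def)
  qed
  have "interval_multiplicity K p I = interval_multiplicity L p I" for I
    by (cases I) (simp_all add: betti top Let_def flip: N_def N'_def)
  then show ?thesis by (simp add: persistence_intervals_def)
qed

section \<open>Column reduction\<close>

lemma low_properties:
  assumes "nonzero_col R j"
  shows "low R j < dim_row R" "R $$ (low R j, j) \<noteq> 0"
    "\<And>i. i < dim_row R \<Longrightarrow> R $$ (i, j) \<noteq> 0 \<Longrightarrow> i \<le> low R j"
proof -
  let ?I = "{i. i < dim_row R \<and> R $$ (i, j) \<noteq> 0}"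
  have "?I \<noteq> {}" using assms by (auto simp: nonzero_col_def)
  then have "low R j \<in> ?I" unfolding low_def by (intro Max_in) simp_all
  then show "low R j < dim_row R" "R $$ (low R j, j) \<noteq> 0" by simp_all
  show "i \<le> low R j" if "i < dim_row R" "R $$ (i, j) \<noteq> 0" for i
    using that unfolding low_def by simp
qed

definition strictly_graded :: "nat \<Rightarrow> (nat \<Rightarrow> int) \<Rightarrow> 'f::field mat \<Rightarrow> bool" where
  "strictly_graded n g R \<longleftrightarrow> dim_row R = n \<and> dim_col R = n \<and>
    (\<forall>i<n. \<forall>j<n. R $$ (i, j) \<noteq> 0 \<longrightarrow> g i < g j)"

context
  fixes n :: nat and g :: "nat \<Rightarrow> int"
  assumes mono: "\<And>i j. i \<le> j \<Longrightarrow> j < n \<Longrightarrow> g i \<le> g j"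
begin

text \<open>The entry at the common low cancels and both columns are zero in all later rows, so the
  low decreases or the column becomes zero. As \<open>low\<close> is unspecified on a zero column,
  \<open>bound\<close> gives that case 0 and shifts all others by one.\<close>

lemma cancel_low_step:
  fixes R :: "'f::field mat"
  assumes R: "strictly_graded n g R" and j: "j < n" and clash: "\<exists>k. low_clash j R k"
  defines "bound \<equiv> \<lambda>R :: 'f mat. if nonzero_col R j then Suc (low R j) else 0"
  shows "strictly_graded n g (cancel_low j R)" "bound (cancel_low j R) < bound R"
proof -
  define k where "k = (LEAST k. low_clash j R k)"
  define l where "l = low R j"
  define a where "a = - (R $$ (l, j) / R $$ (l, k))"
  have "low_clash j R k" unfolding k_def using clash by (rule LeastI_ex)
  then have k: "k < j" "nonzero_col R k" "nonzero_col R j" "low R k = l"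
    by (simp_all add: low_clash_def l_def)
  have dim: "dim_row R = n" "dim_col R = n" using R by (simp_all add: strictly_graded_def)
  have R': "cancel_low j R = addcol a j k R"
    by (simp add: cancel_low_def Let_def k_def l_def a_def)
  have entry: "cancel_low j R $$ (i, m) = (if m = j then a * R $$ (i, k) + R $$ (i, j) else R $$ (i, m))"
    if "i < n" "m < n" for i m
    using that dim by (simp add: R')
  show "strictly_graded n g (cancel_low j R)"
    unfolding strictly_graded_def
  proof (intro conjI allI impI)
    show "dim_row (cancel_low j R) = n" "dim_col (cancel_low j R) = n" by (simp_all add: R' dim)
    fix i m assume im: "i < n" "m < n" "cancel_low j R $$ (i, m) \<noteq> 0"
    then consider "R $$ (i, m) \<noteq> 0" | "m = j" "R $$ (i, k) \<noteq> 0"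
      by (cases "R $$ (i, k) = 0") (auto simp: entry split: if_splits)
    then show "g i < g m"
    proof cases
      case 1
      then show ?thesis using R im by (simp add: strictly_graded_def)
    next
      case 2
      then have "g i < g k" using R im k(1) j by (simp add: strictly_graded_def)
      then show ?thesis using 2 mono[of k j] k(1) j by simp
    qed
  qed
  have "i < l" if "i < n" "cancel_low j R $$ (i, j) \<noteq> 0" for i
  proof (rule ccontr)
    assume "\<not> i < l"
    moreover have "i \<noteq> l"
      using that j low_properties(2)[OF k(2)] by (auto simp: entry a_def k(4))
    ultimately have "l < i" by simp
    then have "R $$ (i, j) = 0" "R $$ (i, k) = 0"
      using low_properties(3)[OF k(3), of i] low_properties(3)[OF k(2), of i] that(1) k(4)
      by (auto simp: dim l_def)
    then show False using that j by (simp add: entry)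
  qed
  then show "bound (cancel_low j R) < bound R"
    using k(3) low_properties(1,2)[of "cancel_low j R" j]
    by (auto simp: bound_def R' dim l_def)
qed

text \<open>The rule for \<open>while\<close> demands termination along with the invariant, hence
  the measure.\<close>

lemma strictly_graded_reduce_col:
  assumes "strictly_graded n g R" "j < n"
  shows "strictly_graded n g (reduce_col j R)"
  unfolding reduce_col_def
  by (rule while_rule2[where P = "strictly_graded n g"
        and r = "measure (\<lambda>R. if nonzero_col R j then Suc (low R j) else 0)"])
    (use assms in \<open>simp_all only: in_measure wf_measure simp_thms cancel_low_step\<close>)

lemma strictly_graded_standard_reduction:
  assumes "strictly_graded n g R"
  shows "strictly_graded n g (standard_reduction R)"
  unfolding standard_reduction_def
  by (rule fold_invariant[where Q = "\<lambda>j. j < n"])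
    (use assms strictly_graded_reduce_col in \<open>auto simp: strictly_graded_def\<close>)

end

text \<open>
  Reduction adds a column only to columns of at least the same filtration value, so a column of
  value \<open>t\<close> keeps its entries in rows of value less than \<open>t\<close>; hence no pair \<open>(low j, j)\<close> has
  length \<open>0\<close>.
\<close>

lemma (in filtered_chain_complex) cell_interval_nonzero_length:
  assumes strict: "\<And>A b. inc K A b \<noteq> 0 \<Longrightarrow> filt K A \<noteq> filt K b"
    and cs: "admissible_listing K cs" and A: "A \<in> cells K"
  shows "\<exists>I. (starts_interval K cs A I \<or> terminates_interval K cs A I) \<and> interval_length I \<noteq> 0"
proof -
  define n where "n = length cs"
  define g where "g i = filt K (cs ! i)" for i
  define R where "R = standard_reduction (boundary_matrix K cs)"
  have "strictly_graded n g (boundary_matrix K cs)"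
    unfolding strictly_graded_def
  proof (intro conjI allI impI)
    fix i j assume "i < n" "j < n" "boundary_matrix K cs $$ (i, j) \<noteq> 0"
    then have "inc K (cs ! j) (cs ! i) \<noteq> 0" by (simp add: boundary_matrix_def n_def)
    then show "g i < g j"
      using strict filt_face by (fastforce simp: g_def face_def)
  qed (simp_all add: boundary_matrix_def n_def)
  then have R: "strictly_graded n g R"
    unfolding R_def
    by (rule strictly_graded_standard_reduction[rotated])
      (use cs in \<open>auto simp: g_def n_def admissible_listing_def sorted_iff_nth_mono\<close>)
  have length: "interval_length (Bounded_Interval (filt K (cs ! low R j)) (filt K (cs ! j))) \<noteq> 0"
    if "j < n" "nonzero_col R j" for j
    using R low_properties[OF that(2)] that(1) by (fastforce simp: strictly_graded_def g_def zero_ereal_def)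
  obtain i where i: "i < n" "A = cs ! i"
    using A cs unfolding admissible_listing_def n_def by (metis in_set_conv_nth)
  \<comment> \<open>Nonzero columns terminate an interval and lows start a bounded one; the indices
    left over are exactly those that start an unbounded one.\<close>
  consider "nonzero_col R i" | j where "j < n" "nonzero_col R j" "i = low R j"
    | "\<not> nonzero_col R i" "\<forall>j<n. nonzero_col R j \<longrightarrow> i \<noteq> low R j"
    by blast
  then show ?thesis
  proof cases
    case 1
    then have "terminates_interval K cs A (Bounded_Interval (filt K (cs ! low R i)) (filt K (cs ! i)))"
      using i by (auto simp: terminates_interval_def Let_def n_def simp flip: R_def)
    then show ?thesis using length[OF i(1) 1] by blast
  next
    case 2
    then have "starts_interval K cs A (Bounded_Interval (filt K (cs ! low R j)) (filt K (cs ! j)))"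
      using i by (auto simp: starts_interval_def Let_def n_def simp flip: R_def)
    then show ?thesis using length[OF 2(1,2)] by blast
  next
    case 3
    then have "starts_interval K cs A (Unbounded_Interval (filt K (cs ! i)))"
      using i by (auto simp: starts_interval_def Let_def n_def simp flip: R_def)
    then show ?thesis by (metis interval_length.simps(2) PInfty_neq_ereal(1) zero_ereal_def)
  qed
qed

section \<open>The iterated Morse complex\<close>

context filtered_matching
begin

text \<open>A fixed point means equality of records, so the incidences must also agree off the
  cells, where both vanish.\<close>

lemma morse_complex_empty:
  assumes "M = {}"
  shows "morse_complex K M = K"
proof -
  have homotopy_empty: "homotopy x = 0" for x
    by (rule homotopy_zero) (simp add: assms)
  have crit: "crit = cells K" by (simp add: assms critical_def)
  have "inc (morse_complex K M) s c = inc K s c" for s c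
    using inc_nonzero[of s c]
    by (auto simp: inc_morse_complex boundary_zero homotopy_empty crit)
  then have "inc (morse_complex K M) = inc K" by blast
  then show ?thesis by (intro cell_complex.equality) (simp_all add: crit)
qed

lemma card_critical:
  assumes "M \<noteq> {}"
  shows "card crit < card (cells K)"
proof (rule psubset_card_mono[OF finite_cells])
  obtain A b where "(A, b) \<in> M" using assms by auto
  then have "A \<in> tops" "A \<in> cells K" using in_tops_bots tops_cells by blast+
  then show "crit \<subset> cells K" by (auto simp: critical_cells)
qed

lemma persistence_intervals_morse_complex:
  "persistence_intervals K p = persistence_intervals (morse_complex K M) p"
  by (rule persistence_intervals_eq)
    (auto simp: finite_cells critical_cells persistent_betti_morse_complex)

end

lemma vital_morse_construction_matching:
  assumes "vital_morse_construction \<M>" "filtered_chain_complex K"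
  obtains M where "filtered_matching K M" "\<M> K = morse_complex K M"
    "M = {} \<Longrightarrow> inc K A b \<noteq> 0 \<Longrightarrow> filt K A \<noteq> filt K b"
proof -
  obtain M where M: "acyclic_matching K M" "compatible K M" "\<M> K = morse_complex K M"
    "(\<exists>A \<in> cells K. \<exists>b \<in> cells K. inc K A b \<noteq> 0 \<and> filt K A = filt K b) \<longrightarrow> M \<noteq> {}"
    using assms unfolding vital_morse_construction_def by blast
  show thesis
    using that[of M] M assms(2) filtered_chain_complex.inc_nonzero[OF assms(2)]
    by (auto simp: filtered_matching_def filtered_matching_axioms_def)
qed

text \<open>An empty matching makes \<open>K\<close> a fixed point, and vitality read
  contrapositively gives the strictness of faces; a nonempty one lowers the number of cells.\<close>

lemma morse_iteration_stabilizes: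
  assumes \<M>: "vital_morse_construction \<M>" and "filtered_chain_complex K"
  shows "\<exists>n L. (\<M> ^^ n) K = L \<and> \<M> L = L \<and> filtered_chain_complex L \<and>
    (\<forall>p. persistence_intervals K p = persistence_intervals L p) \<and>
    (\<forall>A b. inc L A b \<noteq> 0 \<longrightarrow> filt L A \<noteq> filt L b)"
  using assms(2)
proof (induction "card (cells K)" arbitrary: K rule: less_induct)
  case less
  obtain M where M: "filtered_matching K M" "\<M> K = morse_complex K M"
      "\<And>A b. M = {} \<Longrightarrow> inc K A b \<noteq> 0 \<Longrightarrow> filt K A \<noteq> filt K b"
    using vital_morse_construction_matching[OF \<M> less.prems] by metis
  interpret filtered_matching K M by fact
  show ?case
  proof (cases "M = {}")
    case True
    then show ?thesis
      using M(2,3) less.prems morse_complex_empty by (intro exI[of _ 0] exI[of _ K]) auto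
  next
    case False
    then obtain n L where L: "(\<M> ^^ n) (\<M> K) = L" "\<M> L = L" "filtered_chain_complex L"
      "\<forall>p. persistence_intervals (\<M> K) p = persistence_intervals L p"
      "\<forall>A b. inc L A b \<noteq> 0 \<longrightarrow> filt L A \<noteq> filt L b"
      using less.hyps[of "\<M> K"] card_critical filtered_chain_complex_morse_complex M(2) by auto
    moreover have "(\<M> ^^ Suc n) K = L" using L(1) by (simp add: funpow_swap1)
    ultimately show ?thesis
      using persistence_intervals_morse_complex M(2) by metis
  qed
qed

lemma morse_limit_eq:
  assumes "(\<M> ^^ n) K = L" "\<M> L = L"
  shows "morse_limit \<M> K = L"
proof -
  have "(\<M> ^^ m) K = L" if "n \<le> m" for m
    using that
  proof (induction m rule: dec_induct)
    case (step m)
    then show ?case using assms(2) by simp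
  qed (rule assms(1))
  then have ev: "\<forall>\<^sub>F m in sequentially. (\<M> ^^ m) K = L"
    by (auto simp: eventually_sequentially)
  show ?thesis
    unfolding morse_limit_def
  proof (rule the_equality, rule ev)
    fix L' assume "\<forall>\<^sub>F m in sequentially. (\<M> ^^ m) K = L'"
    with ev have "\<forall>\<^sub>F m in sequentially. L' = L" by eventually_elim simp
    then show "L' = L" by simp
  qed
qed

theorem theorem7p1:
  fixes K :: "('c, 'f::field) cell_complex"
    and \<M> :: "('c, 'f) cell_complex \<Rightarrow> ('c, 'f) cell_complex"
  assumes "filtered_chain_complex K"
    and "vital_morse_construction \<M>"
  shows "(\<forall>p. persistence_intervals K p = persistence_intervals (morse_limit \<M> K) p) \<and>
    (\<forall>cs. admissible_listing (morse_limit \<M> K) cs \<longrightarrow>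
      (\<forall>A \<in> cells (morse_limit \<M> K). \<exists>I.
        (starts_interval (morse_limit \<M> K) cs A I \<or> terminates_interval (morse_limit \<M> K) cs A I) \<and>
        interval_length I \<noteq> 0))"
proof -
  obtain n L where L: "(\<M> ^^ n) K = L" "\<M> L = L" "filtered_chain_complex L"
    "\<forall>p. persistence_intervals K p = persistence_intervals L p"
    "\<forall>A b. inc L A b \<noteq> 0 \<longrightarrow> filt L A \<noteq> filt L b"
    using morse_iteration_stabilizes[OF assms(2,1)] by blast
  then show ?thesis
    using filtered_chain_complex.cell_interval_nonzero_length[OF L(3)]
    by (simp add: morse_limit_eq[OF L(1,2)])
qed

end
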